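(* Let $X$ be an open subset of $\mathbb{C}^n$. Then $$V_X\leq E_{\mathcal{B}_{\mathbb{P}^n}^X}I$$ on $\mathbb{C}^n$.
   Context: Notation: $\mathbb{D}$ is the open unit disc in $\mathbb{C}$, and $\mathbb{T}$ is the unit circle with normalized arc length measure $\sigma$; a subset of $\mathbb{T}$ is conull if its complement is $\sigma$-null. $\mathbb{C}^n$ is viewed as the subset of complex projective space $\mathbb{P}^n$, with projective coordinates $[z_0,\dots,z_n]$, where $z_0\neq 0$. Let $\mathbb{C}_*^{n+1}=\mathbb{C}^{n+1}\setminus\{0\}$ and let $\pi:\mathbb{C}_*^{n+1}\to\mathbb{P}^n$ be the projection. An analytic disc in a complex manifold $Y$ is a holomorphic map $\mathbb{D}\to Y$. A holomorphic lifting of an analytic disc $f$ in $\mathbb{P}^n$ is a holomorphic map $\tilde f:\mathbb{D}\to\mathbb{C}_*^{n+1}$ with $\pi\circ\tilde f=f$; it is bounded if its components are bounded. For a bounded holomorphic $\tilde f$, $\tilde f^*$ denotes its nontangential boundary map, defined almost everywhere on $\mathbb{T}$. The Siciak-Zahariuta extremal function: the Lelong class $\mathcal{L}$ is the set of plurisubharmonic functions $u$ on $\mathbb{C}^n$ such that $u-\log^+\|\cdot\|$ is bounded above on $\mathbb{C}^n$ ($\|\cdot\|$ is the Euclidean norm). For $X\subset\mathbb{C}^n$, $V_X(z)=\sup\{u(z): u\in\mathcal{L},\ u|_X\leq 0\}$ for $z\in\mathbb{C}^n$. The class $\mathcal{B}_{\mathbb{P}^n}^X$: the set of all analytic discs $f$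 in $\mathbb{P}^n$ with $f(0)\in\mathbb{C}^n$ that have a bounded holomorphic lifting $\tilde f:\mathbb{D}\to\mathbb{C}_*^{n+1}$ such that the boundary map $f^*=\pi\circ\tilde f^*$ takes a conull subset of $\mathbb{T}$ into $X$. The functional $I$: for an analytic disc $f$ in $\mathbb{P}^n$ with $f(0)\in\mathbb{C}^n$ that has a bounded holomorphic lifting, $$I(f)=-\max_{\tilde f}\log|g(0)|\in[0,\infty),$$ where $\tilde f$ runs through all bounded holomorphic liftings of $f$ and $g$ is the inner factor (in the inner-outer factorization) of the zeroth component of $\tilde f$; the maximum is attained. The envelope of a functional $H:\mathcal{A}\to[-\infty,\infty]$ on a class $\mathcal{A}$ of analytic discs is $E_{\mathcal{A}}H(y)=\inf\{H(f): f\in\mathcal{A},\ f(0)=y\}$, with $\inf\varnothing=\infty$. *)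

theory Defs
  imports "HOL-Complex_Analysis.Complex_Analysis"
begin

abbreviation unit_disc :: "complex set" where
  "unit_disc \<equiv> ball 0 1"

text \<open>Normalized arc length measure, as a Borel measure on the plane that is
  concentrated on the unit circle.\<close>

definition arc_measure :: "complex measure" where
  "arc_measure = distr (uniform_measure lborel {0..<2 * pi}) borel cis"


subsection \<open>Complex projective space\<close>

text \<open>With \<open>n = CARD('n)\<close>, the index type \<open>'n option\<close> has \<open>n + 1\<close> elements; the index
  \<open>None\<close> plays the role of the index 0 and \<open>Some i\<close> that of the indices 1, ..., n.
  The map \<open>cproj_of\<close> generated below is the projection from the nonzero vectors; its value
  at the zero vector carries no information.\<close>

definition same_line :: "complex ^ ('n::finite option) \<Rightarrow> complex ^ ('n option) \<Rightarrow> bool" where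
  "same_line v w \<longleftrightarrow> v \<noteq> 0 \<and> w \<noteq> 0 \<and> (\<exists>c. c \<noteq> 0 \<and> w = c *s v)"

lemma part_equivp_same_line: "part_equivp (same_line :: complex ^ ('n::finite option) \<Rightarrow> _)"
proof (rule part_equivpI)
  have "same_line (1 :: complex ^ ('n option)) 1"
    unfolding same_line_def by (auto simp: vec_eq_iff intro!: exI[of _ 1])
  then show "\<exists>v :: complex ^ ('n option). same_line v v" ..
  show "symp (same_line :: complex ^ ('n option) \<Rightarrow> _)"
  proof (rule sympI)
    fix v w :: "complex ^ ('n option)"
    assume "same_line v w"
    then obtain c where c: "v \<noteq> 0" "w \<noteq> 0" "c \<noteq> 0" "w = c *s v"
      unfolding same_line_def by blast
    then have "inverse c \<noteq> 0 \<and> v = inverse c *s w"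
      by (simp add: vector_smult_assoc)
    then show "same_line w v" using c unfolding same_line_def by blast
  qed
  show "transp (same_line :: complex ^ ('n option) \<Rightarrow> _)"
  proof (rule transpI)
    fix u v w :: "complex ^ ('n option)"
    assume "same_line u v" "same_line v w"
    then obtain c d where c: "u \<noteq> 0" "w \<noteq> 0" "c \<noteq> 0" "d \<noteq> 0" "v = c *s u" "w = d *s v"
      unfolding same_line_def by blast
    then have "d * c \<noteq> 0 \<and> w = (d * c) *s u"
      by (simp add: vector_smult_assoc)
    then show "same_line u w" using c unfolding same_line_def by blast
  qed
qed

quotient_type (overloaded) 'n cproj = "complex ^ ('n::finite option)" / partial: same_line
  morphisms rep_cproj cproj_of
  by (rule part_equivp_same_line)

lift_definition coord_nonzero :: "('n::finite) cproj \<Rightarrow> 'n option \<Rightarrow> bool"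
  is "\<lambda>(v :: complex ^ _) j. v $ j \<noteq> 0"
  by (auto simp: same_line_def fun_eq_iff)

lift_definition coord_ratio :: "('n::finite) cproj \<Rightarrow> 'n option \<Rightarrow> 'n option \<Rightarrow> complex"
  is "\<lambda>(v :: complex ^ _) j i. v $ i / v $ j"
  by (auto simp: same_line_def fun_eq_iff)

definition affine_emb :: "complex ^ ('n::finite) \<Rightarrow> 'n cproj" where
  "affine_emb z = cproj_of (\<chi> k. case k of None \<Rightarrow> 1 | Some i \<Rightarrow> z $ i)"

text \<open>Holomorphy is expressed in the standard affine charts: on the open set where the
  \<open>j\<close>-th homogeneous coordinate is nonzero, the chart is given by the ratios of the
  coordinates to the \<open>j\<close>-th one.\<close>

definition analytic_disc :: "(complex \<Rightarrow> ('n::finite) cproj) \<Rightarrow> bool" where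
  "analytic_disc f \<longleftrightarrow>
     (\<forall>z\<in>unit_disc. \<exists>U j. open U \<and> z \<in> U \<and> U \<subseteq> unit_disc \<and>
        (\<forall>w\<in>U. coord_nonzero (f w) j) \<and>
        (\<forall>i. (\<lambda>w. coord_ratio (f w) j i) holomorphic_on U))"

definition bounded_lifting ::
    "(complex \<Rightarrow> ('n::finite) cproj) \<Rightarrow> (complex \<Rightarrow> complex ^ ('n option)) \<Rightarrow> bool" where
  "bounded_lifting f F \<longleftrightarrow>
     (\<forall>k. (\<lambda>z. F z $ k) holomorphic_on unit_disc) \<and>
     (\<forall>z\<in>unit_disc. F z \<noteq> 0 \<and> cproj_of (F z) = f z) \<and>
     (\<forall>k. bounded ((\<lambda>z. F z $ k) ` unit_disc))"

subsection \<open>Boundary values and the inner-outer factorization\<close>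

definition stolz_region :: "real \<Rightarrow> complex \<Rightarrow> complex set" where
  "stolz_region M \<zeta> = {z \<in> unit_disc. norm (z - \<zeta>) < M * (1 - norm z)}"

definition has_nt_limit :: "(complex \<Rightarrow> 'a::topological_space) \<Rightarrow> complex \<Rightarrow> 'a \<Rightarrow> bool" where
  "has_nt_limit F \<zeta> w \<longleftrightarrow> (\<forall>M>1. (F \<longlongrightarrow> w) (at \<zeta> within stolz_region M \<zeta>))"

definition inner_function :: "(complex \<Rightarrow> complex) \<Rightarrow> bool" where
  "inner_function g \<longleftrightarrow>
     g holomorphic_on unit_disc \<and> (\<forall>z\<in>unit_disc. norm (g z) \<le> 1) \<and>
     (AE \<zeta> in arc_measure. \<exists>w. has_nt_limit g \<zeta> w \<and> norm w = 1)"

definition outer_function :: "(complex \<Rightarrow> complex) \<Rightarrow> bool" where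
  "outer_function h \<longleftrightarrow>
     (\<exists>c k. norm c = 1 \<and> k \<in> borel_measurable arc_measure \<and>
        (\<forall>\<zeta>\<in>sphere 0 1. k \<zeta> > (0::real)) \<and> integrable arc_measure (\<lambda>\<zeta>. ln (k \<zeta>)) \<and>
        (\<forall>z\<in>unit_disc.
           h z = c * exp (LINT \<zeta>|arc_measure. (\<zeta> + z) / (\<zeta> - z) * of_real (ln (k \<zeta>)))))"

definition inner_factor :: "(complex \<Rightarrow> complex) \<Rightarrow> (complex \<Rightarrow> complex) \<Rightarrow> bool" where
  "inner_factor g F \<longleftrightarrow>
     inner_function g \<and> (\<exists>h. outer_function h \<and> (\<forall>z\<in>unit_disc. F z = g z * h z))"

subsection \<open>The class of discs, the functional and the envelope\<close>

definition disc_class :: "(complex ^ ('n::finite)) set \<Rightarrow> (complex \<Rightarrow> 'n cproj) set" where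
  "disc_class X =
     {f. analytic_disc f \<and> f 0 \<in> range affine_emb \<and>
         (\<exists>F. bounded_lifting f F \<and>
              (AE \<zeta> in arc_measure.
                 \<exists>w. has_nt_limit F \<zeta> w \<and> w \<noteq> 0 \<and> cproj_of w \<in> affine_emb ` X))}"

text \<open>The supremum below is the maximum over all bounded holomorphic liftings, which is
  attained. For discs centred in the affine part, the zeroth component of a lifting does
  not vanish at 0, hence neither does its inner factor, and the logarithm is the usual
  one. The inner factor is unique only up to a unimodular constant, which does not
  affect \<open>norm (g 0)\<close>.\<close>

definition disc_functional :: "(complex \<Rightarrow> ('n::finite) cproj) \<Rightarrow> ereal" where
  "disc_functional f =
     - Sup {ereal (ln (norm (g 0))) | F g.
              bounded_lifting f F \<and> inner_factor g (\<lambda>z. F z $ None)}"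

definition envelope ::
    "(complex \<Rightarrow> 'a) set \<Rightarrow> ((complex \<Rightarrow> 'a) \<Rightarrow> ereal) \<Rightarrow> 'a \<Rightarrow> ereal" where
  "envelope A H y = Inf {H f | f. f \<in> A \<and> f 0 = y}"

subsection \<open>Plurisubharmonic functions and the Siciak-Zahariuta function\<close>

text \<open>Integral of an extended real function, as the difference of the integrals of its
  positive and negative parts. It is only used for functions bounded above on the unit
  circle, so that at most the second integral is infinite.\<close>

definition ext_integral :: "'a measure \<Rightarrow> ('a \<Rightarrow> ereal) \<Rightarrow> ereal" where
  "ext_integral M u =
     enn2ereal (\<integral>\<^sup>+ x. e2ennreal (u x) \<partial>M) - enn2ereal (\<integral>\<^sup>+ x. e2ennreal (- u x) \<partial>M)"

definition upper_semicont :: "('a::topological_space \<Rightarrow> ereal) \<Rightarrow> bool" where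
  "upper_semicont u \<longleftrightarrow> (\<forall>c. open {x. u x < c})"

text \<open>Functions on the whole plane and the whole space; the constant \<open>-\<infinity>\<close> is admitted.\<close>

definition subharmonic :: "(complex \<Rightarrow> ereal) \<Rightarrow> bool" where
  "subharmonic u \<longleftrightarrow>
     (\<forall>z. u z < \<infinity>) \<and> upper_semicont u \<and>
     (\<forall>a. \<forall>r>0. u a \<le> ext_integral arc_measure (\<lambda>\<zeta>. u (a + of_real r * \<zeta>)))"

definition plurisubharmonic :: "(complex ^ ('n::finite) \<Rightarrow> ereal) \<Rightarrow> bool" where
  "plurisubharmonic u \<longleftrightarrow>
     (\<forall>z. u z < \<infinity>) \<and> upper_semicont u \<and> (\<forall>a b. subharmonic (\<lambda>l. u (a + l *s b)))"

definition log_plus :: "real \<Rightarrow> real" where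
  "log_plus t = (if t \<le> 1 then 0 else ln t)"

definition lelong_class :: "(complex ^ ('n::finite) \<Rightarrow> ereal) set" where
  "lelong_class =
     {u. plurisubharmonic u \<and> (\<exists>C::real. \<forall>z. u z - ereal (log_plus (norm z)) \<le> ereal C)}"

definition siciak :: "(complex ^ ('n::finite)) set \<Rightarrow> complex ^ 'n \<Rightarrow> ereal" where
  "siciak X z = Sup {u z | u. u \<in> lelong_class \<and> (\<forall>x\<in>X. u x \<le> 0)}"

end

theory Submission
  imports Defs
begin

text \<open>Let \<open>u\<close> be in the Lelong class with \<open>u \<le> 0\<close> on \<open>X\<close>, and let \<open>G\<close> be a bounded lifting of
  \<open>f\<close> with zeroth component \<open>G\<^sub>0\<close> bounded by 1. The logarithmic growth of \<open>u\<close> makes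
  \<open>u \<circ> f + ln \<bar>G\<^sub>0\<bar>\<close> bounded above, also near the poles of \<open>f\<close>, which are the zeros of
  \<open>G\<^sub>0\<close>; an additional \<open>\<epsilon> ln \<bar>G\<^sub>0\<bar>\<close> makes it tend to \<open>-\<infinity>\<close> there. As \<open>X\<close> is open, on circles
  of radius close to 1 the disc lies in \<open>X\<close> outside a set of small measure, which is covered
  by a harmonic majorant with small value at 0. The maximum principle then gives
  \<open>u (f 0) \<le> - ln \<bar>G\<^sub>0 0\<bar>\<close>. Given any bounded lifting whose zeroth component has inner factor \<open>g\<close>,
  division by suitable outer functions produces such \<open>G\<close> with \<open>\<bar>G\<^sub>0 0\<bar>\<close> as close to \<open>\<bar>g 0\<bar>\<close> as we
  please.\<close>

section \<open>Circle means and the arc length measure\<close>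

lemma sets_arc_measure [measurable_cong, simp]: "sets arc_measure = sets borel"
  by (simp add: arc_measure_def)

lemma space_arc_measure [simp]: "space arc_measure = UNIV"
  by (simp add: arc_measure_def)

lemma measurable_arc_measure [simp]: "borel_measurable arc_measure = borel_measurable borel"
  by (intro measurable_cong_sets) simp_all

lemma measurable_cis [measurable]: "cis \<in> borel_measurable borel"
  by (intro borel_measurable_continuous_onI continuous_intros)

lemma measurable_cis_uniform: "cis \<in> measurable (uniform_measure lborel A) borel"
  by (simp add: measurable_cong_sets[OF sets_uniform_measure refl])

lemma AE_arc_norm: "AE \<zeta> in arc_measure. norm \<zeta> = 1"
  unfolding arc_measure_def by (subst AE_distr_iff) (auto intro: measurable_cis_uniform)

lemma finite_measure_arc: "finite_measure arc_measure"
proof (rule finite_measureI)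
  have "emeasure arc_measure (space arc_measure) =
      emeasure (uniform_measure lborel {0..<2 * pi}) UNIV"
    unfolding arc_measure_def by (simp add: emeasure_distr measurable_cis_uniform)
  also have "\<dots> = 1" by (simp add: divide_eq_1_ennreal)
  finally show "emeasure arc_measure (space arc_measure) \<noteq> \<infinity>" by simp
qed

text \<open>Transfers a gauge integral over the parameter interval to \<open>arc_measure\<close>. As
  \<open>f\<close> is continuous only on the circle, the indicator makes the integrand Borel on the
  whole plane.\<close>

lemma has_bochner_integral_arc:
  fixes f :: "complex \<Rightarrow> complex" and I :: complex
  assumes f: "continuous_on (sphere 0 1) f"
    and I: "((\<lambda>t. f (cis t)) has_integral 2 * pi * I) {0..2 * pi}"
  shows "has_bochner_integral arc_measure (\<lambda>\<zeta>. indicator (sphere 0 1) \<zeta> *\<^sub>R f \<zeta>) I"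
proof -
  let ?g = "\<lambda>\<zeta>. indicator (sphere 0 1) \<zeta> *\<^sub>R f \<zeta>"
  have m: "?g \<in> borel_measurable borel"
    by (intro borel_measurable_continuous_on_indicator f) auto
  have c: "continuous_on {0..2*pi} (\<lambda>t. f (cis t))"
    by (intro continuous_on_compose2[OF f] continuous_intros) auto
  have si: "set_integrable lborel {0..2*pi} (\<lambda>t. f (cis t))"
    by (intro borel_integrable_atLeastAtMost' c)
  have "(LINT t:{0..2*pi}|lborel. f (cis t)) = 2 * pi * I"
    using set_borel_integral_eq_integral[OF si] I by (simp add: integral_unique)
  with si have "has_bochner_integral lborel (\<lambda>t. indicator {0..2*pi} t *\<^sub>R f (cis t)) (2 * pi * I)"
    by (simp add: set_integrable_def set_lebesgue_integral_def has_bochner_integral_iff)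
  from has_bochner_integral_scaleR_right[of "1/(2*pi)", OF this]
  have "has_bochner_integral lborel (\<lambda>t. (1/(2*pi)) *\<^sub>R (indicator {0..2*pi} t *\<^sub>R f (cis t))) I"
    by (simp add: scaleR_conv_of_real)
  then have *: "has_bochner_integral lborel (\<lambda>t. (indicator {0..<2*pi} t / (2*pi)) *\<^sub>R ?g (cis t)) I"
  proof (rule has_bochner_integral_cong_AE[THEN iffD1, rotated -1])
    \<comment> \<open>The closed interval and the half-open one underlying
      \<open>arc_measure\<close> differ only in the null point \<open>2*pi\<close>.\<close>
    show "AE t in lborel. (1/(2*pi)) *\<^sub>R (indicator {0..2*pi} t *\<^sub>R f (cis t)) =
        (indicator {0..<2*pi} t / (2*pi)) *\<^sub>R ?g (cis t)"
      using AE_lborel_singleton[of "2*pi"]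
      by eventually_elim (auto simp: indicator_def)
    show "(\<lambda>t. (1/(2*pi)) *\<^sub>R (indicator {0..2*pi} t *\<^sub>R f (cis t))) \<in> borel_measurable lborel"
      using si unfolding set_integrable_def by measurable
    show "(\<lambda>t. (indicator {0..<2*pi} t / (2*pi)) *\<^sub>R ?g (cis t)) \<in> borel_measurable lborel"
      using measurable_compose[OF measurable_cis m] by measurable
  qed
  have "has_bochner_integral (uniform_measure lborel {0..<2*pi}) (\<lambda>t. ?g (cis t)) I"
  proof -
    have "uniform_measure lborel {0..<2*pi} = density lborel (\<lambda>t. ennreal (indicator {0..<2*pi} t / (2*pi)))"
      unfolding uniform_measure_def
      by (intro density_cong) (auto simp: indicator_def divide_ennreal[symmetric] ennreal_1[symmetric] simp del: ennreal_1)
    moreover have "has_bochner_integral (density lborel (\<lambda>t. ennreal (indicator {0..<2*pi} t / (2*pi)))) (\<lambda>t. ?g (cis t)) I"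
      using * measurable_compose[OF measurable_cis m]
      by (intro has_bochner_integral_density) auto
    ultimately show ?thesis by simp
  qed
  then show ?thesis unfolding arc_measure_def
    by (intro has_bochner_integral_distr measurable_cis_uniform m)
qed

text \<open>Cauchy's formula at the centre: along the parametrised circle, \<open>W u / u\<close>
  times the velocity is \<open>\<i> * W u\<close>.\<close>

lemma holomorphic_mean_value:
  assumes W: "W holomorphic_on ball 0 \<rho>" and "0 < r" "r < \<rho>"
  shows "has_bochner_integral arc_measure
    (\<lambda>\<zeta>. indicator (sphere 0 1) \<zeta> *\<^sub>R W (of_real r * \<zeta>)) (W 0)"
proof (rule has_bochner_integral_arc)
  have sub: "cball 0 r \<subseteq> ball (0::complex) \<rho>" using assms by auto
  have c: "continuous_on (cball 0 r) W"
    using W sub by (meson continuous_on_subset holomorphic_on_imp_continuous_on)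
  show "continuous_on (sphere 0 1) (\<lambda>\<zeta>. W (of_real r * \<zeta>))"
    by (intro continuous_on_compose2[OF c] continuous_intros) (use assms in \<open>auto simp: norm_mult\<close>)
  have "((\<lambda>u. W u / (u - 0)) has_contour_integral (2 * of_real pi * \<i> * W 0)) (circlepath 0 r)"
    using assms sub by (intro Cauchy_integral_circlepath_simple holomorphic_on_subset[OF W]) auto
  then have "((\<lambda>t. W (of_real r * cis t) / (of_real r * cis t) * of_real r * \<i> * cis t) has_integral
      (2 * of_real pi * \<i> * W 0)) {0..2*pi}"
    unfolding circlepath_def by (simp add: has_contour_integral_part_circlepath_iff algebra_simps)
  from has_integral_mult_right[OF this, of "-\<i>"] assms
  show "((\<lambda>t. W (of_real r * cis t)) has_integral of_real (2 * pi) * W 0) {0..2*pi}"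
    by (simp add: field_simps)
qed

lemma holomorphic_mean_value_Re:
  assumes W: "W holomorphic_on ball 0 \<rho>" and "0 < r" "r < \<rho>"
  shows "has_bochner_integral arc_measure
    (\<lambda>\<zeta>. indicator (sphere 0 1) \<zeta> * Re (W (of_real r * \<zeta>))) (Re (W 0))"
  using has_bochner_integral_bounded_linear[OF bounded_linear_Re holomorphic_mean_value[OF assms]]
  by simp

text \<open>The positive and negative parts are compared separately; integrability of
  \<open>b\<close> makes both of its parts finite, so their difference is a real number.\<close>

lemma ext_integral_le:
  assumes le: "AE x in M. u x \<le> ereal (b x)" and b: "has_bochner_integral M b c"
  shows "ext_integral M u \<le> ereal c"
proof -
  have "integrable M b" and c: "c = integral\<^sup>L M b" using b by (auto simp: has_bochner_integral_iff)
  then have "integrable M (\<lambda>x. max 0 (b x))" "integrable M (\<lambda>x. max 0 (- b x))" by auto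
  note fin = this[THEN nn_integral_eq_integral]
  have 1: "(\<integral>\<^sup>+ x. e2ennreal (u x) \<partial>M) \<le> ennreal (\<integral>x. max 0 (b x) \<partial>M)" (is "?p \<le> ennreal ?P")
    by (subst fin(1)[symmetric], simp, rule nn_integral_mono_AE)
       (use le in eventually_elim, metis e2ennreal_ereal e2ennreal_mono ennreal_max_0)
  have 2: "ennreal (\<integral>x. max 0 (- b x) \<partial>M) \<le> (\<integral>\<^sup>+ x. e2ennreal (- u x) \<partial>M)" (is "ennreal ?Q \<le> ?q")
    by (subst fin(2)[symmetric], simp, rule nn_integral_mono_AE)
       (use le in eventually_elim, metis e2ennreal_ereal e2ennreal_mono ennreal_max_0 ereal_minus_le_minus uminus_ereal.simps(1))
  have "?P \<ge> 0" "?Q \<ge> 0" by auto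
  have "ext_integral M u \<le> enn2ereal (ennreal ?P) - enn2ereal (ennreal ?Q)"
    unfolding ext_integral_def
    by (intro ereal_minus_mono) (use 1 2 in \<open>auto simp: less_eq_ennreal.rep_eq\<close>)
  also have "\<dots> = ereal (?P - ?Q)" by (simp add: enn2ereal_ennreal)
  also have "?P - ?Q = (\<integral>x. max 0 (b x) - max 0 (- b x) \<partial>M)"
    using \<open>integrable M b\<close> by (subst Bochner_Integration.integral_diff) auto
  also have "\<dots> = c" unfolding c by (intro Bochner_Integration.integral_cong) auto
  finally show ?thesis .
qed

text \<open>The form in which the sub-mean-value property is used: the mean of the majorant
  \<open>Re (W t)\<close> over the circle is its value at the centre.\<close>

lemma subharmonic_le_holomorphic:
  assumes v: "subharmonic v" and W: "W holomorphic_on ball 0 \<rho>" and r: "0 < r" "r < \<rho>"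
    and le: "\<And>t. norm t = r \<Longrightarrow> v t \<le> ereal (Re (W t))"
  shows "v 0 \<le> ereal (Re (W 0))"
proof -
  have "v 0 \<le> ext_integral arc_measure (\<lambda>\<zeta>. v (0 + of_real r * \<zeta>))"
    using v r unfolding subharmonic_def by blast
  also have "\<dots> \<le> ereal (Re (W 0))"
  proof (rule ext_integral_le[OF _ holomorphic_mean_value_Re[OF W r]])
    show "AE \<zeta> in arc_measure. v (0 + of_real r * \<zeta>) \<le>
        ereal (indicator (sphere 0 1) \<zeta> * Re (W (of_real r * \<zeta>)))"
      using AE_arc_norm
      by eventually_elim (use le r in \<open>auto simp: norm_mult indicator_def\<close>)
  qed
  finally show ?thesis .
qed


section \<open>A maximum principle along holomorphic discs\<close>

text \<open>The sum is below \<open>c\<close> exactly when some real \<open>a\<close> satisfies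
  \<open>u (p x) < a\<close> and \<open>a + q x < c\<close>. The set is therefore a union of
  intersections of two relatively open sets.\<close>

lemma openin_upper_semicont_plus:
  fixes u :: "'b::topological_space \<Rightarrow> ereal" and p :: "'a::topological_space \<Rightarrow> 'b"
  assumes u: "upper_semicont u" "\<And>z. u z < \<infinity>"
    and p: "continuous_on S p" and q: "continuous_on S q"
  shows "openin (top_of_set S) {x \<in> S. u (p x) + ereal (q x) < c}"
proof -
  have "openin (top_of_set S) {x \<in> S. u (p x) < ereal a \<and> ereal (a + q x) < c}" for a
  proof -
    have "openin (top_of_set S) (S \<inter> p -` {z. u z < ereal a})"
      using u(1) by (intro continuous_openin_preimage_gen p) (simp add: upper_semicont_def)
    moreover have "openin (top_of_set S) (S \<inter> (\<lambda>x. ereal (a + q x)) -` {..<c})"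
      by (intro continuous_openin_preimage_gen continuous_intros q)
    ultimately have "openin (top_of_set S) ((S \<inter> p -` {z. u z < ereal a}) \<inter> (S \<inter> (\<lambda>x. ereal (a + q x)) -` {..<c}))"
      by blast
    moreover have "(S \<inter> p -` {z. u z < ereal a}) \<inter> (S \<inter> (\<lambda>x. ereal (a + q x)) -` {..<c})
        = {x \<in> S. u (p x) < ereal a \<and> ereal (a + q x) < c}" by auto
    ultimately show ?thesis by simp
  qed
  then have "openin (top_of_set S) (\<Union>a. {x \<in> S. u (p x) < ereal a \<and> ereal (a + q x) < c})"
    by blast
  moreover have "(\<exists>a. u (p x) < ereal a \<and> ereal (a + q x) < c) \<longleftrightarrow> u (p x) + ereal (q x) < c" for x
  proof
    assume "\<exists>a. u (p x) < ereal a \<and> ereal (a + q x) < c"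
    then obtain a where "u (p x) < ereal a" "ereal (a + q x) < c" by blast
    then show "u (p x) + ereal (q x) < c" by (cases "u (p x)"; cases c) auto
  next
    assume *: "u (p x) + ereal (q x) < c"
    then have "u (p x) < c - ereal (q x)" using u(2)[of "p x"] by (cases "u (p x)"; cases c) auto
    then obtain a where "u (p x) < ereal a" "ereal a < c - ereal (q x)" using ereal_dense2 by blast
    then show "\<exists>a. u (p x) < ereal a \<and> ereal (a + q x) < c"
      by (intro exI[of _ a]) (cases c; auto)
  qed
  then have "(\<Union>a. {x \<in> S. u (p x) < ereal a \<and> ereal (a + q x) < c}) = {x \<in> S. u (p x) + ereal (q x) < c}"
    by auto
  ultimately show ?thesis by simp
qed

text \<open>Without a maximum, the sets where \<open>\<Phi> x < \<Phi> y\<close>, for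
  \<open>y\<close> in \<open>K\<close>, form an open cover of \<open>K\<close>; in a finite subcover
  the \<open>y\<close> with the largest value is left uncovered.\<close>

lemma upper_semicont_attains_max:
  fixes \<Phi> :: "'a::topological_space \<Rightarrow> ereal"
  assumes K: "compact K" "K \<noteq> {}" and \<Phi>: "\<And>c. openin (top_of_set K) {x \<in> K. \<Phi> x < c}"
  shows "\<exists>x\<in>K. \<forall>y\<in>K. \<Phi> y \<le> \<Phi> x"
proof (rule ccontr)
  assume "\<not> ?thesis"
  then have "\<exists>y\<in>K. \<Phi> x < \<Phi> y" if "x \<in> K" for x
    using that by (meson not_le)
  then have "K \<subseteq> (\<Union>y\<in>K. {x \<in> K. \<Phi> x < \<Phi> y})" by auto
  moreover have "\<forall>c\<in>(\<lambda>y. {x \<in> K. \<Phi> x < \<Phi> y}) ` K. openin (top_of_set K) c"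
    using \<Phi> by blast
  ultimately obtain \<D> where "\<D> \<subseteq> (\<lambda>y. {x \<in> K. \<Phi> x < \<Phi> y}) ` K" "finite \<D>" "K \<subseteq> \<Union>\<D>"
    using K(1) unfolding compact_eq_openin_cover by meson
  then obtain D where D: "D \<subseteq> K" "finite D" "K \<subseteq> (\<Union>y\<in>D. {x \<in> K. \<Phi> x < \<Phi> y})"
    using finite_subset_image[of \<D> "\<lambda>y. {x \<in> K. \<Phi> x < \<Phi> y}" K] by blast
  then have "D \<noteq> {}" using K(2) by auto
  with D(2) have "Max (\<Phi> ` D) \<in> \<Phi> ` D" by (intro Max_in) auto
  then obtain y where y: "y \<in> D" "\<Phi> y = Max (\<Phi> ` D)" by auto
  then obtain y' where "y' \<in> D" "\<Phi> y < \<Phi> y'" using D by blast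
  moreover have "\<Phi> y' \<le> \<Phi> y" using y D(2) \<open>y' \<in> D\<close> by simp
  ultimately show False by simp
qed

text \<open>First-order expansion in each coordinate with error
  \<open>\<kappa> / ?n * norm t\<close>; the Euclidean norm is at most the sum of the coordinate
  norms.\<close>

lemma vec_difference_quotient:
  fixes \<phi> :: "complex \<Rightarrow> complex ^ ('n::finite)"
  assumes "\<And>i. ((\<lambda>z. \<phi> z $ i) has_field_derivative b $ i) (at a)" and "\<kappa> > 0"
  obtains r where "r > 0" "\<And>t :: complex. norm t < r \<Longrightarrow> norm (\<phi> a + t *s b - \<phi> (a + t)) \<le> \<kappa> * norm t"
proof -
  let ?n = "real CARD('n)"
  have "\<exists>r>0. \<forall>t :: complex. norm t < r \<longrightarrow> norm (\<phi> (a + t) $ i - \<phi> a $ i - b $ i * t) \<le> \<kappa> / ?n * norm t" for i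
  proof -
    have "((\<lambda>z. \<phi> z $ i) has_derivative (*) (b $ i)) (at a)"
      using assms(1) by (simp add: has_field_derivative_def)
    moreover have "\<kappa> / ?n > 0" using \<open>\<kappa> > 0\<close> by simp
    ultimately obtain r where r: "r > 0" and
      *: "\<And>y. norm (y - a) < r \<Longrightarrow> norm (\<phi> y $ i - \<phi> a $ i - b $ i * (y - a)) \<le> \<kappa> / ?n * norm (y - a)"
      unfolding has_derivative_at_alt by blast
    show ?thesis using r *[of "a + _"] by auto
  qed
  then obtain r where r: "\<And>i. r i > 0"
      "\<And>i t. norm t < r i \<Longrightarrow> norm (\<phi> (a + t) $ i - \<phi> a $ i - b $ i * t) \<le> \<kappa> / ?n * norm t"
    by metis
  have fin: "finite (range r)" by simp
  show thesis
  proof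
    show "Min (range r) > 0" using r(1) by (subst Min_gr_iff) auto
    fix t :: complex assume t: "norm t < Min (range r)"
    have "norm (\<phi> a + t *s b - \<phi> (a + t)) \<le> (\<Sum>i\<in>UNIV. norm ((\<phi> a + t *s b - \<phi> (a + t)) $ i))"
      by (simp add: norm_vec_def L2_set_le_sum)
    also have "\<dots> \<le> (\<Sum>i\<in>(UNIV::'n set). \<kappa> / ?n * norm t)"
    proof (rule sum_mono)
      fix i
      have "norm t < r i" using t fin by (subst (asm) Min_gr_iff) auto
      from r(2)[OF this] show "norm ((\<phi> a + t *s b - \<phi> (a + t)) $ i) \<le> \<kappa> / ?n * norm t"
        by (subst norm_minus_cancel[symmetric]) (simp add: algebra_simps)
    qed
    also have "\<dots> = \<kappa> * norm t" by simp
    finally show "norm (\<phi> a + t *s b - \<phi> (a + t)) \<le> \<kappa> * norm t" .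
  qed
qed

text \<open>Exhibits the cross term in the square of \<open>norm (y + R t)\<close> as the real part
  of an expression linear in \<open>R t\<close>, so that it can enter a holomorphic
  majorant.\<close>

lemma inner_vec_complex:
  fixes y R :: "complex ^ 'n"
  shows "inner y R = Re (\<Sum>i\<in>UNIV. cnj (y $ i) * R $ i)"
  by (simp add: inner_vec_def inner_complex_def)

text \<open>If \<open>(a, y)\<close> were a maximum point of \<open>u (\<phi> w + x) + Re (L w) + \<delta> \<bar>w\<bar>\<^sup>2 - j \<bar>x\<bar>\<^sup>2\<close>, then we could
  follow the complex line through \<open>\<phi> a + y\<close> in the direction of the derivative \<open>b\<close> of \<open>\<phi>\<close>.
  Writing its point at time \<open>t\<close> as \<open>\<phi> (a + t) + x\<close> gives \<open>x = y + R t\<close> with \<open>R t = o(t)\<close>, so the mean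
  of the penalty term exceeds \<open>j \<bar>y\<bar>\<^sup>2\<close> only by \<open>o(\<bar>t\<bar>\<^sup>2)\<close>, and \<open>\<delta>\<close> wins. This only uses
  subharmonicity on lines.\<close>

lemma plurisubharmonic_no_local_max:
  fixes u :: "complex ^ ('n::finite) \<Rightarrow> ereal" and \<phi> :: "complex \<Rightarrow> complex ^ 'n"
  assumes u: "plurisubharmonic u" and fin: "u (\<phi> a + y) = ereal m"
    and r: "r > 0" and \<phi>: "\<And>i. (\<lambda>z. \<phi> z $ i) holomorphic_on ball a r"
    and L: "L holomorphic_on ball a r"
    and y: "norm y < 1" and \<delta>: "\<delta> > 0" and j: "j > 0"
    and max: "\<And>w x. w \<in> ball a r \<Longrightarrow> norm x \<le> 1 \<Longrightarrow>
      u (\<phi> w + x) + ereal (Re (L w) + \<delta> * (norm w)\<^sup>2 - j * (norm x)\<^sup>2) \<le>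
      ereal (m + Re (L a) + \<delta> * (norm a)\<^sup>2 - j * (norm y)\<^sup>2)"
  shows False
proof -
  \<comment> \<open>With this slope the penalty \<open>j * (norm (R t))\<^sup>2\<close> costs at
    most half of the gain \<open>\<delta> * (norm t)\<^sup>2\<close>.\<close>
  define \<kappa> where "\<kappa> = sqrt (\<delta> / (2 * j))"
  have \<kappa>: "\<kappa> > 0" "j * \<kappa>\<^sup>2 = \<delta> / 2" using \<delta> j by (auto simp: \<kappa>_def)
  define b where "b = (\<chi> i. deriv (\<lambda>z. \<phi> z $ i) a)"
  have "((\<lambda>z. \<phi> z $ i) has_field_derivative b $ i) (at a)" for i
    using \<phi>[of i] r by (simp add: b_def holomorphic_derivI[of _ "ball a r"])
  from vec_difference_quotient[OF this \<kappa>(1)] obtain s where s: "s > 0"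
    "\<And>t. norm t < s \<Longrightarrow> norm (\<phi> a + t *s b - \<phi> (a + t)) \<le> \<kappa> * norm t" by metis
  define R where "R t = \<phi> a + t *s b - \<phi> (a + t)" for t
  \<comment> \<open>The last bound keeps \<open>y + R t\<close> in the closed unit ball, where
    \<open>max\<close> applies.\<close>
  define \<epsilon> where "\<epsilon> = min (min (s/2) (r/2)) ((1 - norm y) / \<kappa>)"
  have \<epsilon>: "0 < \<epsilon>" "\<epsilon> < s" "\<epsilon> < r" "\<kappa> * \<epsilon> \<le> 1 - norm y"
  proof -
    have "\<epsilon> \<le> (1 - norm y) / \<kappa>" by (simp add: \<epsilon>_def)
    then show "\<kappa> * \<epsilon> \<le> 1 - norm y" using \<kappa> by (simp add: field_simps)
  qed (use s r y \<kappa> in \<open>auto simp: \<epsilon>_def\<close>)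
  define \<theta> where "\<theta> = (\<delta> / 2) * \<epsilon>\<^sup>2"
  \<comment> \<open>On \<open>norm t = \<epsilon>\<close> the two squared norms in
    \<open>max\<close> expand into constants, real parts of holomorphic terms, and remainders. The
    remainders contribute a gain of \<open>2 * \<theta>\<close> and a loss of at most
    \<open>\<theta>\<close>, whence the term \<open>- \<theta>\<close>. At \<open>t = 0\<close> only
    this term separates \<open>Re (W t)\<close> from \<open>m\<close>.\<close>
  define W where "W t = of_real (m + Re (L a) - \<theta>) - L (a + t) - 2 * of_real \<delta> * cnj a * t
      + 2 * of_real j * (\<Sum>i\<in>UNIV. cnj (y $ i) * R t $ i)" for t
  have shift: "(\<lambda>t. f (a + t)) holomorphic_on ball 0 r" if "f holomorphic_on ball a r" for f
    by (rule holomorphic_on_compose_gen[OF _ that, unfolded o_def])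
       (auto intro!: holomorphic_intros simp: dist_norm)
  have "W holomorphic_on ball 0 r"
    unfolding W_def R_def by (auto intro!: holomorphic_intros shift L \<phi>)
  have "u (\<phi> a + y + 0 *s b) \<le> ereal (Re (W 0))"
  proof (rule subharmonic_le_holomorphic[where v = "\<lambda>l. u (\<phi> a + y + l *s b)", OF _ \<open>W holomorphic_on ball 0 r\<close> \<epsilon>(1,3)])
    show "subharmonic (\<lambda>l. u (\<phi> a + y + l *s b))"
      using u unfolding plurisubharmonic_def by blast
    fix t :: complex assume t: "norm t = \<epsilon>"
    have R: "norm (R t) \<le> \<kappa> * \<epsilon>" using s(2)[of t] t \<epsilon> by (simp add: R_def)
    then have "norm (y + R t) \<le> 1" using norm_triangle_ineq[of y "R t"] \<epsilon> by simp
    moreover have "a + t \<in> ball a r" using t \<epsilon> by (simp add: dist_norm)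
    moreover have "\<phi> (a + t) + (y + R t) = \<phi> a + y + t *s b" by (simp add: R_def algebra_simps)
    ultimately have "u (\<phi> a + y + t *s b) + ereal (Re (L (a + t)) + \<delta> * (norm (a + t))\<^sup>2 - j * (norm (y + R t))\<^sup>2)
        \<le> ereal (m + Re (L a) + \<delta> * (norm a)\<^sup>2 - j * (norm y)\<^sup>2)"
      using max by metis
    then have "u (\<phi> a + y + t *s b) \<le> ereal (m + Re (L a) + \<delta> * (norm a)\<^sup>2 - j * (norm y)\<^sup>2
        - (Re (L (a + t)) + \<delta> * (norm (a + t))\<^sup>2 - j * (norm (y + R t))\<^sup>2))"
      by (cases "u (\<phi> a + y + t *s b)") auto
    also have "\<dots> \<le> ereal (Re (W t))"
    proof -
      have 1: "(norm (a + t))\<^sup>2 = (norm a)\<^sup>2 + 2 * Re (cnj a * t) + \<epsilon>\<^sup>2"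
        using t by (simp add: power2_norm_eq_inner inner_add inner_commute inner_complex_def algebra_simps flip: t)
      have 2: "(norm (y + R t))\<^sup>2 = (norm y)\<^sup>2 + 2 * Re (\<Sum>i\<in>UNIV. cnj (y $ i) * R t $ i) + (norm (R t))\<^sup>2"
        unfolding inner_vec_complex[symmetric]
        by (simp add: power2_norm_eq_inner inner_add inner_commute)
      have "(norm (R t))\<^sup>2 \<le> \<kappa>\<^sup>2 * \<epsilon>\<^sup>2" using R by (metis norm_ge_zero power_mono power_mult_distrib)
      then have "j * (norm (R t))\<^sup>2 \<le> (j * \<kappa>\<^sup>2) * \<epsilon>\<^sup>2" using j by simp
      then have 3: "j * (norm (R t))\<^sup>2 \<le> \<theta>" by (simp add: \<kappa> \<theta>_def)
      have "Re (W t) = m + Re (L a) - \<theta> - Re (L (a + t)) - 2 * \<delta> * Re (cnj a * t)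
          + 2 * j * Re (\<Sum>i\<in>UNIV. cnj (y $ i) * R t $ i)"
        unfolding W_def by (simp add: algebra_simps)
      moreover have "\<delta> * \<epsilon>\<^sup>2 = 2 * \<theta>" by (simp add: \<theta>_def)
      ultimately show ?thesis using 3 unfolding 1 2 by (simp add: distrib_left)
    qed
    finally show "u (\<phi> a + y + t *s b) \<le> ereal (Re (W t))" .
  qed
  moreover have "Re (W 0) = m - \<theta>" by (simp add: W_def R_def)
  moreover have "\<theta> > 0" using \<delta> \<epsilon> by (simp add: \<theta>_def)
  ultimately show False using fin by simp
qed

text \<open>Phrased by local real parts because the comparison on circles needs the holomorphic
  function itself.\<close>

definition harmonic_on :: "(complex \<Rightarrow> real) \<Rightarrow> complex set \<Rightarrow> bool" where
  "harmonic_on H S \<longleftrightarrow>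
     (\<forall>x\<in>S. \<exists>r>0. \<exists>L. L holomorphic_on ball x r \<and> (\<forall>y\<in>ball x r. H y = Re (L y)))"

lemma harmonic_on_imp_continuous_on:
  assumes "harmonic_on H S" shows "continuous_on S H"
proof (rule continuous_at_imp_continuous_on, rule ballI)
  fix x assume "x \<in> S"
  with assms obtain r L where r: "r > 0" and L: "L holomorphic_on ball x r" "\<forall>y\<in>ball x r. H y = Re (L y)"
    unfolding harmonic_on_def by blast
  have "continuous_on (ball x r) (\<lambda>y. Re (L y))"
    using L(1) by (intro continuous_intros holomorphic_on_imp_continuous_on)
  moreover have "continuous_on (ball x r) H \<longleftrightarrow> continuous_on (ball x r) (\<lambda>y. Re (L y))"
    using L(2) by (intro continuous_on_cong) auto
  ultimately have "continuous_on (ball x r) H" by simp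
  then show "isCont H x" using r by (simp add: continuous_on_eq_continuous_at)
qed

text \<open>The image of \<open>\<phi>\<close> is curved, whereas \<open>plurisubharmonic\<close>
  speaks of complex lines. A shift \<open>x\<close> in the unit ball is therefore added to
  \<open>\<phi> w\<close> and penalised by \<open>j\<close>. For large \<open>j\<close> a maximum
  point has a small shift and lies over the interior of \<open>K\<close>, which
  \<open>plurisubharmonic_no_local_max\<close> excludes.\<close>

lemma plurisubharmonic_maximum_principle:
  fixes u :: "complex ^ ('n::finite) \<Rightarrow> ereal" and \<phi> :: "complex \<Rightarrow> complex ^ 'n"
  assumes u: "plurisubharmonic u"
    and \<Omega>: "open \<Omega>" and \<phi>: "\<And>i. (\<lambda>z. \<phi> z $ i) holomorphic_on \<Omega>" and H: "harmonic_on H \<Omega>"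
    and K: "compact K" "K \<subseteq> \<Omega>"
    and bd: "\<And>x. x \<in> frontier K \<Longrightarrow> u (\<phi> x) + ereal (H x) \<le> 0"
    and x0: "x0 \<in> K"
  shows "u (\<phi> x0) + ereal (H x0) \<le> 0"
proof (rule ccontr)
  assume "\<not> ?thesis"
  then obtain c where c: "0 < ereal c" "ereal c < u (\<phi> x0) + ereal (H x0)"
    using ereal_dense2 by (metis not_le)
  have usc: "upper_semicont u" "\<And>z. u z < \<infinity>" using u by (auto simp: plurisubharmonic_def)
  have c\<phi>: "continuous_on K \<phi>"
  proof -
    have "continuous_on K (\<lambda>z. \<chi> i. \<phi> z $ i)"
      using \<phi> K by (intro continuous_on_vec_lambda) (meson continuous_on_subset holomorphic_on_imp_continuous_on)
    then show ?thesis by simp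
  qed
  have cH: "continuous_on K H"
    using harmonic_on_imp_continuous_on[OF H] K(2) by (rule continuous_on_subset)
  obtain B where B: "B > 0" "\<And>x. x \<in> K \<Longrightarrow> norm x \<le> B"
    using compact_imp_bounded[OF K(1)] bounded_pos by blast
  \<comment> \<open>Small enough that \<open>\<delta> * (norm x)\<^sup>2\<close> cannot lift the
    frontier values from 0 to \<open>c\<close>.\<close>
  define \<delta> where "\<delta> = c / (2 * B\<^sup>2)"
  have \<delta>: "\<delta> > 0" using c B by (simp add: \<delta>_def)
  have \<delta>B: "\<delta> * (norm x)\<^sup>2 < c" if "x \<in> K" for x
  proof -
    have "\<delta> * (norm x)\<^sup>2 \<le> \<delta> * B\<^sup>2" using B that \<delta> by (intro mult_left_mono power_mono) auto
    also have "\<dots> < c" using B c by (simp add: \<delta>_def)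
    finally show ?thesis .
  qed
  define q where "q j x = H (fst x) + \<delta> * (norm (fst x))\<^sup>2 - j * (norm (snd x))\<^sup>2"
    for j :: real and x :: "complex \<times> (complex ^ 'n)"
  define \<Phi> where "\<Phi> j x = u (\<phi> (fst x) + snd x) + ereal (q j x)" for j x
  let ?Q = "K \<times> cball (0 :: complex ^ 'n) 1"
  have cQ: "compact ?Q" using K by (intro compact_Times) auto
  have x0Q: "(x0, 0) \<in> ?Q" using x0 by simp
  have op: "openin (top_of_set S) {x \<in> S. \<Phi> j x < d}" if "S \<subseteq> ?Q" for S j d
    unfolding \<Phi>_def q_def
    by (intro openin_upper_semicont_plus usc continuous_intros
        continuous_on_compose2[OF c\<phi>] continuous_on_compose2[OF cH])
       (use that in auto)
  have max: "\<exists>x\<in>?Q. \<forall>y\<in>?Q. \<Phi> j y \<le> \<Phi> j x" for j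
    using upper_semicont_attains_max[OF cQ _ op[OF subset_refl]] x0Q by blast
  have mono: "\<Phi> j x = \<Phi> 0 x - ereal (j * (norm (snd x))\<^sup>2)" for j x
    by (cases "u (\<phi> (fst x) + snd x)") (auto simp: \<Phi>_def q_def)
  obtain M where M: "\<And>x. x \<in> ?Q \<Longrightarrow> \<Phi> 0 x \<le> ereal M"
  proof -
    obtain x where x: "\<forall>y\<in>?Q. \<Phi> 0 y \<le> \<Phi> 0 x" using max by blast
    have "\<Phi> 0 x < \<infinity>" unfolding \<Phi>_def using usc(2)[of "\<phi> (fst x) + snd x"] by simp
    then obtain M where "\<Phi> 0 x \<le> ereal M" using less_PInf_Ex_of_nat by (metis less_imp_le ereal_dense2)
    with x show thesis using that order_trans by blast
  qed
  have fr: "frontier K \<subseteq> K" using K(1) by (simp add: compact_imp_closed frontier_subset_closed)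
  \<comment> \<open>Points over the frontier at which the unpenalised function reaches
    \<open>c\<close>. By the boundary assumption none has shift 0, so compactness bounds their
    shifts below by some \<open>s\<close>.\<close>
  define T where "T = {x \<in> frontier K \<times> cball 0 1. ereal c \<le> \<Phi> 0 x}"
  have "compact T"
  proof -
    let ?S = "frontier K \<times> cball (0 :: complex ^ 'n) 1"
    have "compact ?S" using K by (intro compact_Times) (auto simp: compact_frontier)
    moreover have "closedin (top_of_set ?S) T"
    proof -
      have "openin (top_of_set ?S) {x \<in> ?S. \<Phi> 0 x < ereal c}" by (rule op) (use fr in auto)
      then have "closedin (top_of_set ?S) (?S - {x \<in> ?S. \<Phi> 0 x < ereal c})"
        by (intro closedin_diff) auto
      then show ?thesis by (rule back_subst[of "closedin _"]) (auto simp: T_def)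
    qed
    ultimately show ?thesis using closedin_compact by blast
  qed
  obtain s where s: "0 < s" "s \<le> 1" "\<And>x. x \<in> T \<Longrightarrow> s \<le> norm (snd x)"
  proof (cases "T = {}")
    case True then show thesis using that[of 1] by auto
  next
    case False
    have "continuous_on T (\<lambda>x. norm (snd x))" by (intro continuous_intros)
    from continuous_attains_inf[OF \<open>compact T\<close> False this]
    obtain x where x: "x \<in> T" "\<And>y. y \<in> T \<Longrightarrow> norm (snd x) \<le> norm (snd y)" by blast
    have "snd x \<noteq> 0"
    proof
      assume 0: "snd x = 0"
      have xK: "fst x \<in> frontier K" using x by (auto simp: T_def)
      have "\<Phi> 0 x = (u (\<phi> (fst x)) + ereal (H (fst x))) + ereal (\<delta> * (norm (fst x))\<^sup>2)"
        by (cases "u (\<phi> (fst x))") (auto simp: \<Phi>_def q_def 0)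
      also have "\<dots> \<le> 0 + ereal (\<delta> * (norm (fst x))\<^sup>2)" by (intro add_right_mono bd xK)
      also have "\<dots> < ereal c" using \<delta>B[of "fst x"] xK fr by auto
      finally show False using x by (auto simp: T_def)
    qed
    moreover have "norm (snd x) \<le> 1" using x by (auto simp: T_def)
    ultimately show thesis using x that[of "norm (snd x)"] by auto
  qed
  \<comment> \<open>At shifts of norm at least \<open>s\<close> the penalised function is at most
    \<open>M - j * s\<^sup>2\<close>, hence below \<open>c\<close>, whereas its value at
    \<open>(x0, 0)\<close> is at least \<open>c\<close>.\<close>
  define j where "j = (\<bar>M\<bar> + 1) / s\<^sup>2"
  have j: "j > 0" "j * s\<^sup>2 > M - c" using s c by (auto simp: j_def)
  obtain a y where ay: "a \<in> K" "norm y \<le> 1" and mx: "\<And>x. x \<in> ?Q \<Longrightarrow> \<Phi> j x \<le> \<Phi> j (a, y)"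
    using max[of j] by auto
  have "ereal c \<le> \<Phi> j (x0, 0)"
  proof -
    have "\<Phi> j (x0, 0) = (u (\<phi> x0) + ereal (H x0)) + ereal (\<delta> * (norm x0)\<^sup>2)"
      by (cases "u (\<phi> x0)") (auto simp: \<Phi>_def q_def)
    also have "\<dots> \<ge> ereal c + 0" using c \<delta> by (intro add_mono) auto
    finally show ?thesis by simp
  qed
  with mx[OF x0Q] have cay: "ereal c \<le> \<Phi> j (a, y)" by (rule order_trans[rotated])
  have c0: "ereal (c + j * (norm y)\<^sup>2) \<le> \<Phi> 0 (a, y)"
    using cay unfolding mono[of j] by (cases "\<Phi> 0 (a, y)") auto
  also have "\<dots> \<le> ereal M" using ay by (intro M) auto
  finally have "j * (norm y)\<^sup>2 < j * s\<^sup>2" using j(2) by (simp del: mult_less_cancel_left_pos)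
  then have ys: "norm y < s" using j s by (simp add: power_less_imp_less_base)
  have "a \<notin> frontier K"
  proof
    assume "a \<in> frontier K"
    moreover have "ereal c \<le> \<Phi> 0 (a, y)" using c0 j by (elim order_trans[rotated]) simp
    ultimately have "(a, y) \<in> T" using ay by (simp add: T_def)
    with s(3) ys show False by fastforce
  qed
  then have aint: "a \<in> interior K" using ay closure_subset by (auto simp: frontier_def)
  obtain m where m: "u (\<phi> a + y) = ereal m"
    using cay usc(2)[of "\<phi> a + y"] by (cases "u (\<phi> a + y)") (auto simp: \<Phi>_def)
  obtain r1 where r1: "r1 > 0" "ball a r1 \<subseteq> K" using aint by (meson mem_interior)
  obtain r2 L where r2: "r2 > 0" "L holomorphic_on ball a r2" "\<forall>x\<in>ball a r2. H x = Re (L x)"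
    using H ay K unfolding harmonic_on_def by blast
  show False
  proof (rule plurisubharmonic_no_local_max[where r = "min r1 r2" and \<phi> = \<phi> and L = L, OF u m])
    show "norm y < 1" using ys s by simp
    show "\<And>i. (\<lambda>z. \<phi> z $ i) holomorphic_on ball a (min r1 r2)"
      using r1 K by (intro holomorphic_on_subset[OF \<phi>]) auto
    show "L holomorphic_on ball a (min r1 r2)" using r2 by (elim holomorphic_on_subset) auto
    fix w x assume *: "w \<in> ball a (min r1 r2)" "norm (x :: complex ^ 'n) \<le> 1"
    then have "(w, x) \<in> ?Q" using r1 by auto
    from mx[OF this] show "u (\<phi> w + x) + ereal (Re (L w) + \<delta> * (norm w)\<^sup>2 - j * (norm x)\<^sup>2) \<le>
      ereal (m + Re (L a) + \<delta> * (norm a)\<^sup>2 - j * (norm y)\<^sup>2)"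
      using * r2 by (simp add: \<Phi>_def q_def m add_diff_eq add.assoc)
  qed (use r1 r2 j \<delta> in auto)
qed


section \<open>Harmonic majorants of small closed sets\<close>

lemma measure_arc_UNIV [simp]: "measure arc_measure UNIV = 1"
proof -
  have "measure arc_measure UNIV = measure (uniform_measure lborel {0..<2 * pi}) UNIV"
    unfolding arc_measure_def by (simp add: measure_distr measurable_cis_uniform)
  also have "\<dots> = 1" by (simp add: measure_def divide_eq_1_ennreal)
  finally show ?thesis .
qed

text \<open>Induction peels the constant coefficients off both polynomials. The factor
  \<open>z * cnj z\<close> of the remaining product is 1 on the circle, and the mixed terms are
  polynomials up to conjugation, which does not change real parts.\<close>

lemma circle_Re_poly_mult_cnj:
  "\<exists>r. \<forall>z::complex. norm z = 1 \<longrightarrow> Re (poly p z * cnj (poly q z)) = Re (poly r z)"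
proof (induction p arbitrary: q)
  case 0
  show ?case by (rule exI[of _ 0]) simp
next
  case (pCons a p)
  obtain b q' where q: "q = pCons b q'" by (cases q)
  obtain r where r: "\<And>z. norm z = 1 \<Longrightarrow> Re (poly p z * cnj (poly q' z)) = Re (poly r z)"
    using pCons.IH[of q'] by blast
  show ?case
  proof (intro exI allI impI)
    fix z :: complex assume z: "norm z = 1"
    then have 1: "z * cnj z = 1" by (simp add: complex_norm_square[symmetric])
    have "poly (pCons a p) z * cnj (poly q z)
        = a * cnj (poly q z) + (z * poly p z * cnj b + (z * cnj z) * (poly p z * cnj (poly q' z)))"
      by (simp add: q algebra_simps)
    also have "Re \<dots> = Re (a * cnj (poly q z)) + Re (z * poly p z * cnj b) + Re (poly r z)"
      unfolding 1 using r[OF z] by simp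
    also have "Re (a * cnj (poly q z)) = Re (cnj a * poly q z)" by simp
    finally show "Re (poly (pCons a p) z * cnj (poly q z)) =
        Re (poly (smult (cnj a) q + pCons 0 (smult (cnj b) p) + r) z)"
      by (simp add: algebra_simps)
  qed
qed

text \<open>Uses \<open>2 * Re a * Re b = Re (a * b + a * cnj b)\<close>.\<close>

lemma circle_Re_poly_mult:
  "\<exists>r. \<forall>z::complex. norm z = 1 \<longrightarrow> Re (poly p z) * Re (poly q z) = Re (poly r z)"
proof -
  obtain r where r: "\<And>z. norm z = 1 \<Longrightarrow> Re (poly p z * cnj (poly q z)) = Re (poly r z)"
    using circle_Re_poly_mult_cnj by blast
  have "Re (poly p z) * Re (poly q z) = Re (poly (smult (1/2) (p * q + r)) z)" if "norm z = 1" for z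
    using r[OF that] by (simp add: field_simps)
  then show ?thesis by blast
qed

text \<open>On the circle, the real parts of complex polynomials contain the constants and the real
  linear functions and are closed under sums and products.\<close>

lemma circle_real_polynomial_function:
  assumes "real_polynomial_function f"
  shows "\<exists>p. \<forall>z::complex. norm z = 1 \<longrightarrow> f z = Re (poly p z)"
  using assms
proof induction
  case (linear f)
  then interpret bounded_linear f .
  have "f z = Re (poly [:0, Complex (f 1) (- f \<i>):] z)" for z
  proof -
    have "f z = f (Re z *\<^sub>R 1 + Im z *\<^sub>R \<i>)"
      by (rule arg_cong[of _ _ f]) (simp add: complex_eq_iff)
    also have "\<dots> = Re z * f 1 + Im z * f \<i>" by (simp only: add scaleR real_scaleR_def)
    finally show ?thesis by simp
  qed
  then show ?case by blast
next
  case (const c)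
  have "c = Re (poly [:of_real c:] z)" for z by simp
  then show ?case by blast
next
  case (add f g)
  then obtain p q where "\<And>z. norm z = 1 \<Longrightarrow> f z = Re (poly p z)" "\<And>z. norm z = 1 \<Longrightarrow> g z = Re (poly q z)"
    by blast
  then show ?case by (intro exI[of _ "p + q"]) simp
next
  case (mult f g)
  then obtain p q where "\<And>z. norm z = 1 \<Longrightarrow> f z = Re (poly p z)" "\<And>z. norm z = 1 \<Longrightarrow> g z = Re (poly q z)"
    by blast
  then show ?case using circle_Re_poly_mult[of p q] by auto
qed

text \<open>Stone-Weierstrass gives an approximate solution of the Dirichlet problem, since
  \<open>Re (poly p z)\<close> is harmonic on the whole plane.\<close>

lemma circle_harmonic_approximation:
  assumes "continuous_on (sphere 0 1) \<psi>" and "e > 0"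
  obtains p :: "complex poly" where "\<And>\<zeta>. norm \<zeta> = 1 \<Longrightarrow> \<bar>\<psi> \<zeta> - Re (poly p \<zeta>)\<bar> < e"
proof -
  obtain g where g: "real_polynomial_function g" "\<And>\<zeta>. \<zeta> \<in> sphere 0 1 \<Longrightarrow> \<bar>\<psi> \<zeta> - g \<zeta>\<bar> < e"
    using Stone_Weierstrass_real_polynomial_function[OF compact_sphere assms] by metis
  obtain p where "\<And>z. norm z = 1 \<Longrightarrow> g z = Re (poly p z)"
    using circle_real_polynomial_function[OF g(1)] by blast
  with g(2) show thesis by (intro that[of p]) simp
qed

text \<open>Continuous functions decreasing to the indicator of \<open>E\<close> have means tending
  to its measure. Approximating one of them from above by a harmonic polynomial turns the mean into
  the value at 0.\<close>

lemma closed_arc_harmonic_majorant: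
  assumes E: "closed E" and e: "e > 0"
  obtains p :: "complex poly" where "\<And>\<zeta>. norm \<zeta> = 1 \<Longrightarrow> 0 \<le> Re (poly p \<zeta>)"
    "\<And>\<zeta>. norm \<zeta> = 1 \<Longrightarrow> \<zeta> \<in> E \<Longrightarrow> 1 \<le> Re (poly p \<zeta>)"
    "Re (poly p 0) < measure arc_measure E + e"
proof (cases "E = {}")
  \<comment> \<open>\<open>infdist\<close> to the empty set is 0, which would make every
    \<open>\<psi> m\<close> equal to 1; a small constant serves instead.\<close>
  case True
  then show thesis using that[of "[:of_real (e/2):]"] e by simp
next
  case False
  interpret finite_measure arc_measure by (rule finite_measure_arc)
  define \<psi> where "\<psi> m \<zeta> = max 0 (1 - real m * infdist \<zeta> E)" for m \<zeta>
  have \<psi>c: "continuous_on UNIV (\<psi> m)" for m unfolding \<psi>_def by (intro continuous_intros)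
  have \<psi>b: "0 \<le> \<psi> m \<zeta>" "\<psi> m \<zeta> \<le> 1" for m \<zeta> by (auto simp: \<psi>_def infdist_nonneg)
  have \<psi>m[measurable]: "\<psi> m \<in> borel_measurable arc_measure" for m
    using \<psi>c by (simp add: borel_measurable_continuous_onI)
  have \<psi>i: "integrable arc_measure (\<psi> m)" for m
    by (rule integrable_const_bound[of _ 1]) (use \<psi>b in auto)
  have "(\<lambda>m. integral\<^sup>L arc_measure (\<psi> m)) \<longlonglongrightarrow> integral\<^sup>L arc_measure (indicator E :: _ \<Rightarrow> real)"
  proof (rule integral_dominated_convergence[where w = "\<lambda>_. 1"])
    show "(indicator E :: _ \<Rightarrow> real) \<in> borel_measurable arc_measure" using E by simp
    show "AE x in arc_measure. (\<lambda>m. \<psi> m x) \<longlonglongrightarrow> indicator E x"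
    proof (rule AE_I2)
      fix x
      show "(\<lambda>m. \<psi> m x) \<longlonglongrightarrow> indicator E x"
      proof (cases "x \<in> E")
        case True then show ?thesis by (simp add: \<psi>_def)
      next
        case False
        then have d: "infdist x E > 0"
          using E \<open>E \<noteq> {}\<close> by (simp add: infdist_pos_not_in_closed)
        obtain n where n: "1 < real n * infdist x E" using reals_Archimedean3[OF d] by blast
        have "\<psi> m x = 0" if "m \<ge> n" for m
        proof -
          have "real n * infdist x E \<le> real m * infdist x E" using that d by simp
          with n show ?thesis by (simp add: \<psi>_def)
        qed
        then have "eventually (\<lambda>m. \<psi> m x = 0) sequentially" by (auto simp: eventually_sequentially)
        with False show ?thesis by (simp add: tendsto_eventually)
      qed
    qed
  qed (use \<psi>b in auto)
  moreover have "integral\<^sup>L arc_measure (indicator E :: _ \<Rightarrow> real) < measure arc_measure E + e / 2"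
    using E e by simp
  ultimately have "eventually (\<lambda>m. integral\<^sup>L arc_measure (\<psi> m) < measure arc_measure E + e / 2) sequentially"
    by (rule order_tendstoD)
  then obtain m where m: "integral\<^sup>L arc_measure (\<psi> m) < measure arc_measure E + e / 2"
    by (auto simp: eventually_sequentially)
  \<comment> \<open>Shift and tolerance \<open>e / 4\<close> place
    \<open>Re (poly p \<zeta>)\<close> between \<open>\<psi> m \<zeta>\<close> and
    \<open>\<psi> m \<zeta> + e / 2\<close> on the circle.\<close>
  have "continuous_on (sphere 0 1) (\<lambda>\<zeta>. \<psi> m \<zeta> + e / 4)"
    by (intro continuous_intros continuous_on_subset[OF \<psi>c]) auto
  with e obtain p where p: "\<And>\<zeta>. norm \<zeta> = 1 \<Longrightarrow> \<bar>\<psi> m \<zeta> + e / 4 - Re (poly p \<zeta>)\<bar> < e / 4"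
    using circle_harmonic_approximation[of _ "e / 4"] by (metis divide_pos_pos zero_less_numeral)
  show thesis
  proof
    fix \<zeta> :: complex assume z: "norm \<zeta> = 1"
    show "0 \<le> Re (poly p \<zeta>)" using p[OF z] \<psi>b(1)[of m \<zeta>] by linarith
    assume "\<zeta> \<in> E"
    then have "\<psi> m \<zeta> = 1" by (simp add: \<psi>_def)
    then show "1 \<le> Re (poly p \<zeta>)" using p[OF z] by linarith
  next
    have "poly p holomorphic_on ball 0 2" by (intro holomorphic_intros)
    from holomorphic_mean_value_Re[OF this, of 1]
    have mv: "has_bochner_integral arc_measure (\<lambda>\<zeta>. indicator (sphere 0 1) \<zeta> * Re (poly p \<zeta>)) (Re (poly p 0))"
      by simp
    have "Re (poly p 0) = (\<integral>\<zeta>. indicator (sphere 0 1) \<zeta> * Re (poly p \<zeta>) \<partial>arc_measure)"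
      using mv by (simp add: has_bochner_integral_iff)
    also have "\<dots> \<le> (\<integral>\<zeta>. \<psi> m \<zeta> + e / 2 \<partial>arc_measure)"
    proof (rule integral_mono_AE)
      show "AE \<zeta> in arc_measure. indicator (sphere 0 1) \<zeta> * Re (poly p \<zeta>) \<le> \<psi> m \<zeta> + e / 2"
        using AE_arc_norm
      proof eventually_elim
        case (elim \<zeta>)
        have "Re (poly p \<zeta>) \<le> \<psi> m \<zeta> + e / 2" using p[OF elim] by linarith
        with elim show ?case by simp
      qed
    qed (use mv \<psi>i in \<open>auto simp: has_bochner_integral_iff\<close>)
    also have "\<dots> = integral\<^sup>L arc_measure (\<psi> m) + e / 2" using \<psi>i by simp
    finally show "Re (poly p 0) < measure arc_measure E + e" using m by simp
  qed
qed

lemma measure_arc_eventually_avoided: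
  assumes E: "\<And>n. closed (E n)"
    and av: "AE \<zeta> in arc_measure. eventually (\<lambda>n. \<zeta> \<notin> E n) sequentially"
  shows "(\<lambda>n. measure arc_measure (E n)) \<longlonglongrightarrow> 0"
proof -
  interpret finite_measure arc_measure by (rule finite_measure_arc)
  have "(\<lambda>n. integral\<^sup>L arc_measure (indicator (E n) :: _ \<Rightarrow> real)) \<longlonglongrightarrow> integral\<^sup>L arc_measure (\<lambda>_. 0 :: real)"
  proof (rule integral_dominated_convergence[where w = "\<lambda>_. 1"])
    show "(indicator (E n) :: _ \<Rightarrow> real) \<in> borel_measurable arc_measure" for n using E by simp
    show "AE x in arc_measure. (\<lambda>n. indicator (E n) x :: real) \<longlonglongrightarrow> 0"
      using av by eventually_elim (rule tendsto_eventually, auto elim!: eventually_mono)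
  qed (auto simp: indicator_def)
  then show ?thesis using E by simp
qed


section \<open>Discs with boundary in an open set\<close>

text \<open>Inverse of \<open>affine_emb\<close> in homogeneous coordinates; where the zeroth
  coordinate is 0, division by zero gives the value 0.\<close>

definition dehomogenize :: "complex ^ ('n::finite option) \<Rightarrow> complex ^ 'n" where
  "dehomogenize v = (\<chi> i. v $ Some i / v $ None)"

lemma same_line_refl: "v \<noteq> 0 \<Longrightarrow> same_line v v"
  unfolding same_line_def by (auto intro!: exI[of _ 1])

lemma cproj_of_eq_imp:
  fixes v w :: "complex ^ ('n::finite option)"
  assumes "v \<noteq> 0" "w \<noteq> 0" "cproj_of v = cproj_of w"
  shows "v $ None \<noteq> 0 \<longleftrightarrow> w $ None \<noteq> 0" "dehomogenize v = dehomogenize w"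
proof -
  note n = coord_nonzero.abs_eq[OF same_line_refl] and r = coord_ratio.abs_eq[OF same_line_refl]
  show "v $ None \<noteq> 0 \<longleftrightarrow> w $ None \<noteq> 0"
    using n[OF assms(1)] n[OF assms(2)] assms(3) by metis
  have "v $ Some i / v $ None = w $ Some i / w $ None" for i
    using r[OF assms(1)] r[OF assms(2)] assms(3) by metis
  then show "dehomogenize v = dehomogenize w" by (simp add: dehomogenize_def)
qed

lemma cproj_of_eq_affine_emb:
  assumes "v \<noteq> 0" "cproj_of v = affine_emb z"
  shows "v $ None \<noteq> 0" "dehomogenize v = z"
proof -
  let ?w = "(\<chi> k. case k of None \<Rightarrow> 1 | Some i \<Rightarrow> z $ i) :: complex ^ ('a option)"
  have "?w $ None \<noteq> 0" by simp
  then have "?w \<noteq> 0" by (metis zero_index)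
  from cproj_of_eq_imp[OF assms(1) this] assms(2)
  show "v $ None \<noteq> 0" "dehomogenize v = z"
    by (auto simp: affine_emb_def dehomogenize_def)
qed

lemma open_dehomogenize_vimage:
  assumes "open X"
  shows "open {v. v $ None \<noteq> 0 \<and> dehomogenize v \<in> X}"
proof -
  let ?S = "{v :: complex ^ ('a option). v $ None \<noteq> 0}"
  have S: "open ?S" by (intro open_Collect_neq continuous_intros)
  have "continuous_on ?S dehomogenize"
    unfolding dehomogenize_def by (intro continuous_intros) auto
  from continuous_open_preimage[OF this S assms]
  have "open (?S \<inter> dehomogenize -` X)" .
  moreover have "?S \<inter> dehomogenize -` X = {v. v $ None \<noteq> 0 \<and> dehomogenize v \<in> X}" by auto
  ultimately show ?thesis by simp
qed

lemma bounded_lifting_continuous_on: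
  assumes "bounded_lifting f F" shows "continuous_on unit_disc F"
proof -
  have "continuous_on unit_disc (\<lambda>z. \<chi> k. F z $ k)"
    using assms unfolding bounded_lifting_def
    by (intro continuous_on_vec_lambda) (blast intro: holomorphic_on_imp_continuous_on)
  then show ?thesis by simp
qed

text \<open>Points of the radius satisfy \<open>norm (z - \<zeta>) = 1 - norm z\<close>, so the
  Stolz region of aperture 2 contains them.\<close>

lemma has_nt_limit_radial:
  assumes lim: "has_nt_limit F \<zeta> w" and \<zeta>: "norm \<zeta> = 1"
    and r: "r \<longlonglongrightarrow> 1" "\<And>n. 0 < r n" "\<And>n. r n < 1"
  shows "(\<lambda>n. F (of_real (r n) * \<zeta>)) \<longlonglongrightarrow> w"
proof -
  have "filterlim (\<lambda>n. of_real (r n) * \<zeta>) (at \<zeta> within stolz_region 2 \<zeta>) sequentially"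
    unfolding filterlim_at
  proof (intro conjI always_eventually allI)
    have "(\<lambda>n. of_real (r n) * \<zeta>) \<longlonglongrightarrow> of_real 1 * \<zeta>"
      by (intro tendsto_intros r)
    then show "(\<lambda>n. of_real (r n) * \<zeta>) \<longlonglongrightarrow> \<zeta>" by simp
    fix n
    have n: "norm (of_real (r n) * \<zeta>) = r n" using \<zeta> r(2)[of n] by (simp add: norm_mult)
    have "of_real (r n) * \<zeta> - \<zeta> = of_real (r n - 1) * \<zeta>" by (simp add: algebra_simps)
    then have "norm (of_real (r n) * \<zeta> - \<zeta>) = 1 - r n"
      using \<zeta> r(3)[of n] by (simp only: norm_mult norm_of_real) simp
    then show "of_real (r n) * \<zeta> \<in> stolz_region 2 \<zeta>"
      using n r(3)[of n] by (simp add: stolz_region_def)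
    show "of_real (r n) * \<zeta> \<noteq> \<zeta>" using n \<zeta> r(3)[of n] by auto
  qed
  moreover have "(F \<longlongrightarrow> w) (at \<zeta> within stolz_region 2 \<zeta>)"
    using lim by (simp add: has_nt_limit_def)
  ultimately show ?thesis by (rule filterlim_compose[rotated])
qed

text \<open>The cone over \<open>X\<close> is open in homogeneous coordinates, so for almost every
  \<open>\<zeta>\<close> the values of \<open>F\<close> along the radius are eventually in it, and
  the exceptional sets shrink to measure 0. Every lifting \<open>G\<close> is covered, because the
  affine point depends only on \<open>f\<close>.\<close>

lemma disc_class_mostly_inside:
  fixes f :: "complex \<Rightarrow> ('n::finite) cproj"
  assumes X: "open X" and f: "f \<in> disc_class X" and e: "e > 0"
  obtains r E where "0 < r" "r < 1" "closed E" "measure arc_measure E < e"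
    "\<And>G \<zeta>. bounded_lifting f G \<Longrightarrow> norm \<zeta> = 1 \<Longrightarrow> \<zeta> \<notin> E \<Longrightarrow> dehomogenize (G (of_real r * \<zeta>)) \<in> X"
proof -
  obtain F where F: "bounded_lifting f F" and
    bv: "AE \<zeta> in arc_measure. \<exists>w. has_nt_limit F \<zeta> w \<and> w \<noteq> 0 \<and> cproj_of w \<in> affine_emb ` X"
    using f unfolding disc_class_def by blast
  define r where "r n = 1 - 1 / (real n + 2)" for n
  have r: "0 < r n" "r n < 1" for n by (auto simp: r_def field_simps)
  have r1: "r \<longlonglongrightarrow> 1" unfolding r_def by real_asymp
  let ?U = "{v. v $ None \<noteq> 0 \<and> dehomogenize v \<in> X}"
  have U: "open ?U" using X by (rule open_dehomogenize_vimage)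
  define E where "E n = {\<zeta> \<in> sphere 0 1. F (of_real (r n) * \<zeta>) \<in> - ?U}" for n
  have inD: "of_real (r n) * \<zeta> \<in> unit_disc" if "norm \<zeta> = 1" for n \<zeta>
    using that r[of n] by (simp add: norm_mult)
  have cl: "closed (E n)" for n
  proof -
    have "continuous_on (sphere 0 1) (\<lambda>\<zeta>. F (of_real (r n) * \<zeta>))"
      by (rule continuous_on_compose2[OF bounded_lifting_continuous_on[OF F]])
         (use inD in \<open>auto intro!: continuous_intros\<close>)
    from continuous_closed_preimage[OF this _ closed_Compl[OF U]]
    have "closed (sphere 0 1 \<inter> (\<lambda>\<zeta>. F (of_real (r n) * \<zeta>)) -` (- ?U))" by simp
    then show ?thesis by (simp add: E_def vimage_def Int_def)
  qed
  have "AE \<zeta> in arc_measure. eventually (\<lambda>n. \<zeta> \<notin> E n) sequentially"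
    using bv AE_arc_norm
  proof eventually_elim
    case (elim \<zeta>)
    then obtain w x where w: "has_nt_limit F \<zeta> w" "w \<noteq> 0" "x \<in> X" "cproj_of w = affine_emb x" by blast
    then have "w \<in> ?U" using cproj_of_eq_affine_emb[OF w(2,4)] by simp
    from topological_tendstoD[OF has_nt_limit_radial[OF w(1) elim(2) r1 r] U this]
    show ?case by eventually_elim (simp add: E_def)
  qed
  from order_tendstoD(2)[OF measure_arc_eventually_avoided[of E, OF cl this] e]
  obtain n where n: "measure arc_measure (E n) < e" by (auto simp: eventually_sequentially)
  show thesis
  proof (rule that[OF r cl n])
    fix G \<zeta> assume G: "bounded_lifting f G" and \<zeta>: "norm \<zeta> = 1" "\<zeta> \<notin> E n"
    let ?z = "of_real (r n) * \<zeta>"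
    have "F ?z \<noteq> 0" "G ?z \<noteq> 0" "cproj_of (F ?z) = cproj_of (G ?z)"
      using F G inD[OF \<zeta>(1)] unfolding bounded_lifting_def by metis+
    from cproj_of_eq_imp[OF this] \<zeta> show "dehomogenize (G ?z) \<in> X" by (simp add: E_def)
  qed
qed

text \<open>The norm of \<open>dehomogenize (G w)\<close> times that of \<open>G w $ None\<close> is
  bounded by the other components of \<open>G\<close>. Adding \<open>ln (norm (G w $ None))\<close>
  thus absorbs the logarithmic growth of \<open>u\<close>.\<close>

lemma lelong_class_along_lifting:
  assumes u: "u \<in> lelong_class" and G: "bounded_lifting f G"
  obtains C where "C > 0"
    "\<And>w. w \<in> unit_disc \<Longrightarrow> G w $ None \<noteq> 0 \<Longrightarrow>
      u (dehomogenize (G w)) + ereal (ln (norm (G w $ None))) \<le> ereal C"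
proof -
  obtain C where C: "\<And>z. u z - ereal (log_plus (norm z)) \<le> ereal C"
    using u unfolding lelong_class_def by blast
  have "\<forall>k. \<exists>b. \<forall>w\<in>unit_disc. norm (G w $ k) \<le> b"
    using G unfolding bounded_lifting_def bounded_iff by auto
  then obtain b where b: "\<And>k w. w \<in> unit_disc \<Longrightarrow> norm (G w $ k) \<le> b k" by metis
  define B where "B = 1 + \<bar>\<Sum>i\<in>UNIV. b (Some i)\<bar> + \<bar>b None\<bar>"
  have B: "B \<ge> 1" by (simp add: B_def)
  show thesis
  \<comment> \<open>The summand 1 makes the constant strictly positive.\<close>
  proof (rule that[of "\<bar>C\<bar> + ln B + 1"])
    show "\<bar>C\<bar> + ln B + 1 > 0" using B ln_ge_zero[OF B] by linarith
    fix w assume w: "w \<in> unit_disc" "G w $ None \<noteq> 0"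
    let ?y = "dehomogenize (G w)" and ?g = "norm (G w $ None)"
    have "norm ?y \<le> (\<Sum>i\<in>UNIV. norm (?y $ i))"
      by (simp add: norm_vec_def L2_set_le_sum)
    then have "norm ?y * ?g \<le> (\<Sum>i\<in>UNIV. norm (?y $ i)) * ?g" by (rule mult_right_mono) simp
    also have "\<dots> = (\<Sum>i\<in>UNIV. norm (G w $ Some i))"
      using w(2) by (simp add: sum_distrib_right dehomogenize_def norm_divide)
    also have "\<dots> \<le> (\<Sum>i\<in>UNIV. b (Some i))" by (intro sum_mono b w)
    also have "\<dots> \<le> B" by (simp add: B_def)
    finally have yB: "norm ?y * ?g \<le> B" .
    have gB: "?g \<le> B" using b[OF w(1), of None] by (simp add: B_def)
    have "log_plus (norm ?y) + ln ?g \<le> ln B"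
    proof (cases "norm ?y \<le> 1")
      case True
      have "ln ?g \<le> ln B" using gB w B by (subst ln_le_cancel_iff) auto
      with True show ?thesis by (simp add: log_plus_def)
    next
      case False
      then have "log_plus (norm ?y) + ln ?g = ln (norm ?y * ?g)"
        using w by (subst ln_mult) (auto simp: log_plus_def)
      moreover have "0 < norm ?y * ?g" using False w by (intro mult_pos_pos) auto
      then have "ln (norm ?y * ?g) \<le> ln B" using yB B by (subst ln_le_cancel_iff) auto
      ultimately show ?thesis by simp
    qed
    then show "u ?y + ereal (ln ?g) \<le> ereal (\<bar>C\<bar> + ln B + 1)"
      using C[of ?y] by (cases "u ?y") auto
  qed
qed

text \<open>The maximum principle is applied on a compact set \<open>K\<close> that avoids the zeros
  of \<open>g\<close>. Its frontier lies in the level set of \<open>norm (g w)\<close> at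
  \<open>\<eta>\<close> together with the circle of radius \<open>r\<close>, where the directions in
  \<open>E\<close> are treated apart.\<close>

lemma lelong_class_le_bounded_lifting:
  fixes X :: "(complex ^ ('n::finite)) set"
  assumes X: "open X" and f: "f \<in> disc_class X" "f 0 = affine_emb z"
    and G: "bounded_lifting f G" "\<And>w. w \<in> unit_disc \<Longrightarrow> norm (G w $ None) \<le> 1"
    and u: "u \<in> lelong_class" "\<And>x. x \<in> X \<Longrightarrow> u x \<le> 0"
  shows "u z \<le> ereal (- ln (norm (G 0 $ None)))"
proof (rule ccontr)
  assume neg: "\<not> ?thesis"
  define g where "g w = G w $ None" for w
  have hol: "(\<lambda>w. G w $ k) holomorphic_on unit_disc" for k
    using G(1) by (simp add: bounded_lifting_def)
  have ghol: "g holomorphic_on unit_disc" using hol[of None] by (simp add: g_def[abs_def])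
  have "G 0 \<noteq> 0" "cproj_of (G 0) = affine_emb z"
    using G(1) f(2) by (auto simp: bounded_lifting_def)
  from cproj_of_eq_affine_emb[OF this] have g0: "g 0 \<noteq> 0" and z: "dehomogenize (G 0) = z"
    by (auto simp: g_def)
  have psh: "plurisubharmonic u" using u by (simp add: lelong_class_def)
  have "u z + ereal (ln (norm (g 0))) > 0"
    using neg by (cases "u z") (auto simp: g_def)
  \<comment> \<open>The margin \<open>\<kappa>\<close> is spent in halves: one on the term with
    \<open>\<epsilon>\<close>, one on the majorant at 0.\<close>
  then obtain \<kappa> where \<kappa>: "\<kappa> > 0" "ereal \<kappa> < u z + ereal (ln (norm (g 0)))"
    using ereal_dense2 by (metis ereal_less(2))
  define \<epsilon> where "\<epsilon> = \<kappa> / (2 * (\<bar>ln (norm (g 0))\<bar> + 1))"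
  have \<epsilon>: "\<epsilon> > 0" using \<kappa> by (simp add: \<epsilon>_def)
  have "\<epsilon> * \<bar>ln (norm (g 0))\<bar> \<le> \<epsilon> * (\<bar>ln (norm (g 0))\<bar> + 1)" using \<epsilon> by simp
  also have "\<dots> = \<kappa> / 2"
  proof -
    have "\<bar>ln (norm (g 0))\<bar> + 1 \<noteq> 0" by linarith
    then show ?thesis by (simp add: \<epsilon>_def divide_simps)
  qed
  finally have \<epsilon>g: "\<bar>\<epsilon> * ln (norm (g 0))\<bar> \<le> \<kappa> / 2" using \<epsilon> by (simp add: abs_mult)
  obtain C where C: "C > 0" "\<And>w. w \<in> unit_disc \<Longrightarrow> g w \<noteq> 0 \<Longrightarrow>
      u (dehomogenize (G w)) + ereal (ln (norm (g w))) \<le> ereal C"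
    using lelong_class_along_lifting[OF u(1) G(1)] unfolding g_def by metis
  \<comment> \<open>\<open>e\<close> counts twice, for the measure of \<open>E\<close> and for the
    error of the majorant, so \<open>P 0\<close> is below \<open>2 * C * e\<close>, which is
    \<open>\<kappa> / 2\<close>.\<close>
  define e where "e = \<kappa> / (4 * C)"
  have e: "e > 0" using \<kappa> C by (simp add: e_def)
  obtain r E where r: "0 < r" "r < 1" and E: "closed E" "measure arc_measure E < e"
    and inX: "\<And>\<zeta>. norm \<zeta> = 1 \<Longrightarrow> \<zeta> \<notin> E \<Longrightarrow> dehomogenize (G (of_real r * \<zeta>)) \<in> X"
    using disc_class_mostly_inside[OF X f(1) e] G(1) by metis
  obtain p :: "complex poly" where p: "\<And>\<zeta>. norm \<zeta> = 1 \<Longrightarrow> 0 \<le> Re (poly p \<zeta>)"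
    "\<And>\<zeta>. norm \<zeta> = 1 \<Longrightarrow> \<zeta> \<in> E \<Longrightarrow> 1 \<le> Re (poly p \<zeta>)"
    "Re (poly p 0) < measure arc_measure E + e"
    using closed_arc_harmonic_majorant[OF E(1) e] by metis
  define P where "P w = C * Re (poly p (w / of_real r))" for w
  have P0: "P 0 < \<kappa> / 2"
  proof -
    have "C * Re (poly p 0) < C * (2 * e)" using p(3) E(2) C(1) by (intro mult_strict_left_mono) auto
    also have "\<dots> = \<kappa> / 2" using C by (simp add: e_def)
    finally show ?thesis by (simp add: P_def)
  qed
  have "continuous_on (cball 0 r) P" unfolding P_def using r by (intro continuous_intros) auto
  then have "compact (P ` cball 0 r)" by (intro compact_continuous_image) auto
  then obtain D where D: "D > 0" "\<And>w. w \<in> cball 0 r \<Longrightarrow> \<bar>P w\<bar> \<le> D"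
    unfolding compact_eq_bounded_closed bounded_pos by auto
  \<comment> \<open>At the level \<open>\<eta>\<close> the extra
    \<open>\<epsilon> * ln (norm (g x))\<close> outweighs the bounds \<open>C\<close> and
    \<open>D\<close>; the minimum with \<open>norm (g 0)\<close> keeps 0 in
    \<open>K\<close>.\<close>
  define \<eta> where "\<eta> = min (norm (g 0)) (exp (- (C + D) / \<epsilon>))"
  have \<eta>: "\<eta> > 0" "\<eta> \<le> norm (g 0)" using g0 by (auto simp: \<eta>_def)
  have ln\<eta>: "\<epsilon> * ln \<eta> \<le> - (C + D)"
  proof -
    have "ln \<eta> \<le> ln (exp (- (C + D) / \<epsilon>))" using \<eta> by (subst ln_le_cancel_iff) (auto simp: \<eta>_def)
    then have "\<epsilon> * ln \<eta> \<le> \<epsilon> * (- (C + D) / \<epsilon>)" using \<epsilon> by (intro mult_left_mono) auto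
    then show ?thesis using \<epsilon> by simp
  qed
  define \<Omega> where "\<Omega> = {w \<in> unit_disc. g w \<noteq> 0}"
  define K where "K = {w \<in> cball 0 r. \<eta> \<le> norm (g w)}"
  \<comment> \<open>One copy of \<open>ln (norm (g w))\<close> offsets the growth of
    \<open>u\<close>, the fraction \<open>\<epsilon>\<close> deals with the zeros of
    \<open>g\<close>, and \<open>P\<close> deals with \<open>E\<close>.\<close>
  define H where "H w = (1 + \<epsilon>) * ln (norm (g w)) - P w" for w
  have gc: "continuous_on unit_disc g" using ghol by (rule holomorphic_on_imp_continuous_on)
  have rD: "cball 0 r \<subseteq> unit_disc" using r by auto
  have \<Omega>: "open \<Omega>"
  proof -
    have "open (unit_disc \<inter> g -` (- {0}))" by (intro continuous_open_preimage gc) auto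
    moreover have "unit_disc \<inter> g -` (- {0}) = \<Omega>" by (auto simp: \<Omega>_def)
    ultimately show ?thesis by simp
  qed
  have K\<Omega>: "K \<subseteq> \<Omega>" using rD \<eta> by (auto simp: K_def \<Omega>_def)
  have "compact K"
  proof -
    have "closed (cball 0 r \<inter> (\<lambda>w. norm (g w)) -` {\<eta>..})"
      by (intro continuous_closed_preimage continuous_intros continuous_on_subset[OF gc rD]) auto
    moreover have "cball 0 r \<inter> (\<lambda>w. norm (g w)) -` {\<eta>..} = K" by (auto simp: K_def)
    ultimately have "closed K" by simp
    moreover have "bounded K" by (rule bounded_subset[OF bounded_cball[of 0 r]]) (auto simp: K_def)
    ultimately show ?thesis by (simp add: compact_eq_bounded_closed)
  qed
  have harm: "harmonic_on H \<Omega>"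
    unfolding harmonic_on_def
  proof
    fix x assume "x \<in> \<Omega>"
    then obtain \<rho> where \<rho>: "\<rho> > 0" "ball x \<rho> \<subseteq> \<Omega>" using \<Omega> by (meson open_contains_ball)
    have "g holomorphic_on ball x \<rho>" using \<rho> by (intro holomorphic_on_subset[OF ghol]) (auto simp: \<Omega>_def)
    then obtain l where l: "l holomorphic_on ball x \<rho>" "\<And>w. w \<in> ball x \<rho> \<Longrightarrow> g w = exp (l w)"
      by (rule contractible_imp_holomorphic_log[where S = "ball x \<rho>"])
         (use \<rho> in \<open>auto simp: \<Omega>_def intro!: convex_imp_contractible\<close>)
    show "\<exists>\<rho>>0. \<exists>L. L holomorphic_on ball x \<rho> \<and> (\<forall>y\<in>ball x \<rho>. H y = Re (L y))"
    proof (intro exI conjI ballI)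
      show "\<rho> > 0" by fact
      show "(\<lambda>w. of_real (1 + \<epsilon>) * l w - of_real C * poly p (w / of_real r)) holomorphic_on ball x \<rho>"
        using r l(1) by (intro holomorphic_intros) auto
      show "H y = Re (of_real (1 + \<epsilon>) * l y - of_real C * poly p (y / of_real r))" if "y \<in> ball x \<rho>" for y
        by (simp add: H_def P_def l(2)[OF that] algebra_simps)
    qed
  qed
  have "u (dehomogenize (G 0)) + ereal (H 0) \<le> 0"
  proof (rule plurisubharmonic_maximum_principle[OF psh \<Omega> _ harm \<open>compact K\<close> K\<Omega>])
    show "(\<lambda>w. dehomogenize (G w) $ i) holomorphic_on \<Omega>" for i
      unfolding dehomogenize_def vec_lambda_beta
      by (intro holomorphic_intros holomorphic_on_subset[OF hol]) (auto simp: \<Omega>_def g_def)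
    show "0 \<in> K" using r \<eta> by (simp add: K_def)
    fix x assume x: "x \<in> frontier K"
    then have xK: "x \<in> K" using \<open>compact K\<close> frontier_subset_closed compact_imp_closed by blast
    then have gx: "g x \<noteq> 0" "x \<in> unit_disc" and xr: "x \<in> cball 0 r" "\<eta> \<le> norm (g x)"
      using K\<Omega> by (auto simp: \<Omega>_def K_def)
    have lng: "ln (norm (g x)) \<le> 0" using gx G(2)[of x] by (simp add: g_def)
    have uC: "u (dehomogenize (G x)) + ereal (ln (norm (g x))) \<le> ereal C" using C(2) gx by blast
    have split: "u (dehomogenize (G x)) + ereal (H x)
        = (u (dehomogenize (G x)) + ereal (ln (norm (g x)))) + ereal (\<epsilon> * ln (norm (g x)) - P x)"
      by (cases "u (dehomogenize (G x))") (auto simp: H_def algebra_simps)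
    consider "norm (g x) = \<eta>" | "norm x = r" | "norm x < r" "norm (g x) > \<eta>"
      using xr by fastforce
    then show "u (dehomogenize (G x)) + ereal (H x) \<le> 0"
    proof cases
      case 1
      have "u (dehomogenize (G x)) + ereal (H x) \<le> ereal C + ereal (- (C + D) + D)"
        unfolding split using uC ln\<eta> D(2)[OF xr(1)] by (intro add_mono) (auto simp: 1)
      then show ?thesis by (simp add: zero_ereal_def)
    next
      case 2
      define \<zeta> where "\<zeta> = x / of_real r"
      have \<zeta>: "norm \<zeta> = 1" "x = of_real r * \<zeta>" using 2 r by (auto simp: \<zeta>_def norm_divide)
      have \<epsilon>l: "\<epsilon> * ln (norm (g x)) \<le> 0" using \<epsilon> lng by (simp add: mult_nonneg_nonpos)
      have Px: "P x = C * Re (poly p \<zeta>)" by (simp add: P_def \<zeta>_def)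
      show ?thesis
      \<comment> \<open>On \<open>E\<close> the majorant cancels the growth bound \<open>C\<close>;
        off \<open>E\<close> the disc lies in \<open>X\<close>, so both summands are
        nonpositive.\<close>
      proof (cases "\<zeta> \<in> E")
        case True
        have "C * 1 \<le> P x" unfolding Px using p(2)[OF \<zeta>(1) True] C(1) by (intro mult_left_mono) auto
        then have "u (dehomogenize (G x)) + ereal (H x) \<le> ereal C + ereal (- C)"
          unfolding split using uC \<epsilon>l by (intro add_mono) auto
        then show ?thesis by (simp add: zero_ereal_def)
      next
        case False
        have "u (dehomogenize (G x)) \<le> 0" using inX[OF \<zeta>(1) False] u(2) \<zeta>(2) by simp
        moreover have "P x \<ge> 0" unfolding Px using p(1)[OF \<zeta>(1)] C(1) by simp
        then have "H x \<le> 0" using lng \<epsilon>l unfolding H_def by (simp add: distrib_right)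
        ultimately have "u (dehomogenize (G x)) + ereal (H x) \<le> 0 + ereal 0" by (intro add_mono) auto
        then show ?thesis by (simp add: zero_ereal_def)
      qed
    next
      case 3
      have "open (ball 0 r \<inter> (\<lambda>w. norm (g w)) -` {\<eta><..})"
        by (intro continuous_open_preimage continuous_intros continuous_on_subset[OF gc]) (use r in auto)
      moreover have "ball 0 r \<inter> (\<lambda>w. norm (g w)) -` {\<eta><..} \<subseteq> K" by (auto simp: K_def)
      ultimately have "x \<in> interior K" using 3 by (intro interiorI[of "ball 0 r \<inter> (\<lambda>w. norm (g w)) -` {\<eta><..}"]) auto
      then show ?thesis using x by (simp add: frontier_def)
    qed
  qed
  then have "u z + ereal (H 0) \<le> 0" by (simp add: z)
  moreover have "H 0 > ln (norm (g 0)) - \<kappa>"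
    using P0 \<epsilon>g by (simp add: H_def algebra_simps abs_le_iff)
  ultimately show False using \<kappa> by (cases "u z") auto
qed


section \<open>Removing the outer factor\<close>

text \<open>Its real part is the Poisson integral of \<open>a\<close>; the exponent in
  \<open>outer_function\<close> is the case of \<open>ln (k \<zeta>)\<close>.\<close>

definition schwarz_integral :: "(complex \<Rightarrow> real) \<Rightarrow> complex \<Rightarrow> complex" where
  "schwarz_integral a z = (LINT \<zeta>|arc_measure. (\<zeta> + z) / (\<zeta> - z) * of_real (a \<zeta>))"

section \<open>Holomorphy and lower bounds of the Schwarz integral\<close>

lemma integrable_arc_bounded_mult:
  fixes b :: "complex \<Rightarrow> complex"
  assumes a: "integrable arc_measure a" and b: "b \<in> borel_measurable borel"
    and le: "\<And>\<zeta>. norm \<zeta> = 1 \<Longrightarrow> norm (b \<zeta>) \<le> B"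
  shows "integrable arc_measure (\<lambda>\<zeta>. b \<zeta> * of_real (a \<zeta>))"
    and "norm (LINT \<zeta>|arc_measure. b \<zeta> * of_real (a \<zeta>)) \<le> B * (LINT \<zeta>|arc_measure. \<bar>a \<zeta>\<bar>)"
proof -
  have [measurable]: "a \<in> borel_measurable borel" using a by (auto dest: borel_measurable_integrable)
  have AE: "AE \<zeta> in arc_measure. norm (b \<zeta> * of_real (a \<zeta>)) \<le> B * \<bar>a \<zeta>\<bar>"
    using AE_arc_norm by eventually_elim (simp add: norm_mult le mult_right_mono)
  have ai: "integrable arc_measure (\<lambda>\<zeta>. B * \<bar>a \<zeta>\<bar>)" using a by simp
  show i: "integrable arc_measure (\<lambda>\<zeta>. b \<zeta> * of_real (a \<zeta>))"
  proof (rule Bochner_Integration.integrable_bound[OF ai])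
    show "(\<lambda>\<zeta>. b \<zeta> * of_real (a \<zeta>)) \<in> borel_measurable arc_measure" using b by simp
    show "AE \<zeta> in arc_measure. norm (b \<zeta> * of_real (a \<zeta>)) \<le> norm (B * \<bar>a \<zeta>\<bar>)"
      using AE by eventually_elim simp
  qed
  have "norm (LINT \<zeta>|arc_measure. b \<zeta> * of_real (a \<zeta>)) \<le> (LINT \<zeta>|arc_measure. norm (b \<zeta> * of_real (a \<zeta>)))"
    by (rule integral_norm_bound)
  also have "\<dots> \<le> (LINT \<zeta>|arc_measure. B * \<bar>a \<zeta>\<bar>)"
    using i ai AE by (intro integral_mono_AE integrable_norm)
  finally show "norm (LINT \<zeta>|arc_measure. b \<zeta> * of_real (a \<zeta>)) \<le> B * (LINT \<zeta>|arc_measure. \<bar>a \<zeta>\<bar>)" by simp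
qed

lemma circle_dist_ge: "norm \<zeta> = 1 \<Longrightarrow> 1 - norm z \<le> norm (\<zeta> - z)" for \<zeta> z :: complex
  using norm_triangle_ineq2[of \<zeta> z] by simp

lemma schwarz_kernel_bound:
  fixes \<zeta> z :: complex
  assumes "norm \<zeta> = 1" "norm z < 1"
  shows "norm ((\<zeta> + z) / (\<zeta> - z)) \<le> 2 / (1 - norm z)"
  unfolding norm_divide using assms circle_dist_ge[of \<zeta> z] norm_triangle_ineq[of \<zeta> z]
  by (intro frac_le) auto

lemma schwarz_integrable:
  assumes "integrable arc_measure a" "norm z < 1"
  shows "integrable arc_measure (\<lambda>\<zeta>. (\<zeta> + z) / (\<zeta> - z) * of_real (a \<zeta>))"
  by (rule integrable_arc_bounded_mult(1)[OF assms(1)]) (use schwarz_kernel_bound assms in auto)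

text \<open>Differentiation under the integral sign:
  \<open>2 * \<zeta> / (\<zeta> - z)\<^sup>2\<close> is the derivative of the Schwarz kernel in
  \<open>z\<close>, and the error kernel \<open>?e\<close> is bounded on the circle by a multiple of
  \<open>norm (w - z)\<close>.\<close>

lemma schwarz_integral_holomorphic:
  assumes a: "integrable arc_measure a"
  shows "schwarz_integral a holomorphic_on unit_disc"
  unfolding holomorphic_on_def
proof
  fix z :: complex assume "z \<in> unit_disc"
  then have z: "norm z < 1" by simp
  \<comment> \<open>Half the distance to the circle, so that points within \<open>d\<close> of
    \<open>z\<close> still have distance at least \<open>d\<close> from the circle.\<close>
  define d where "d = (1 - norm z) / 2"
  have d: "d > 0" using z by (simp add: d_def)
  let ?b = "\<lambda>\<zeta>. 2 * \<zeta> / (\<zeta> - z)\<^sup>2"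
  define D where "D = (LINT \<zeta>|arc_measure. ?b \<zeta> * of_real (a \<zeta>))"
  define M where "M = (LINT \<zeta>|arc_measure. \<bar>a \<zeta>\<bar>)"
  have zd: "d \<le> norm (\<zeta> - z)" if "norm \<zeta> = 1" for \<zeta>
    using circle_dist_ge[OF that, of z] d by (simp add: d_def)
  have bi: "integrable arc_measure (\<lambda>\<zeta>. ?b \<zeta> * of_real (a \<zeta>))"
  proof (rule integrable_arc_bounded_mult(1)[OF a])
    fix \<zeta> :: complex assume \<zeta>: "norm \<zeta> = 1"
    show "norm (?b \<zeta>) \<le> 2 / d\<^sup>2"
      unfolding norm_divide norm_mult norm_power using \<zeta> zd[OF \<zeta>] d
      by (intro frac_le power_mono) auto
  qed auto
  have est: "norm ((schwarz_integral a w - schwarz_integral a z) / (w - z) - D) \<le> norm (w - z) * (2 / d ^ 3 * M)"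
    if w: "norm (w - z) < d" "w \<noteq> z" for w
  proof -
    have w1: "norm w < 1 - d" using w norm_triangle_ineq2[of w z] by (simp add: d_def field_simps)
    have wd: "d \<le> norm (\<zeta> - w)" if "norm \<zeta> = 1" for \<zeta>
      using circle_dist_ge[OF that, of w] w1 by simp
    let ?e = "\<lambda>\<zeta>. 2 * \<zeta> * (w - z) / ((\<zeta> - w) * (\<zeta> - z)\<^sup>2)"
    have iw: "integrable arc_measure (\<lambda>\<zeta>. (\<zeta> + w) / (\<zeta> - w) * of_real (a \<zeta>))"
      and iz: "integrable arc_measure (\<lambda>\<zeta>. (\<zeta> + z) / (\<zeta> - z) * of_real (a \<zeta>))"
      by (rule schwarz_integrable[OF a]; use z w1 d in simp)+
    note iwz = integrable_divide_zero[OF Bochner_Integration.integrable_diff[OF iw iz], of "w - z"]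
    have "(schwarz_integral a w - schwarz_integral a z) / (w - z) - D =
        (LINT \<zeta>|arc_measure. ((\<zeta> + w) / (\<zeta> - w) * of_real (a \<zeta>) - (\<zeta> + z) / (\<zeta> - z) * of_real (a \<zeta>)) / (w - z)
           - ?b \<zeta> * of_real (a \<zeta>))"
      unfolding schwarz_integral_def D_def Bochner_Integration.integral_diff[OF iwz bi]
        integral_divide_zero Bochner_Integration.integral_diff[OF iw iz] ..
    also have "\<dots> = (LINT \<zeta>|arc_measure. ?e \<zeta> * of_real (a \<zeta>))"
    proof (rule integral_cong_AE)
      show "AE \<zeta> in arc_measure. ((\<zeta> + w) / (\<zeta> - w) * of_real (a \<zeta>) - (\<zeta> + z) / (\<zeta> - z) * of_real (a \<zeta>)) / (w - z)
           - ?b \<zeta> * of_real (a \<zeta>) = ?e \<zeta> * of_real (a \<zeta>)"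
        using AE_arc_norm
      proof eventually_elim
        case (elim \<zeta>)
        have nz: "\<zeta> - w \<noteq> 0" "\<zeta> - z \<noteq> 0" "w - z \<noteq> 0" using wd[OF elim] zd[OF elim] d w by auto
        have "((\<zeta> + w) / (\<zeta> - w) - (\<zeta> + z) / (\<zeta> - z)) / (w - z) = 2 * \<zeta> / ((\<zeta> - w) * (\<zeta> - z))"
          using nz by (simp add: divide_simps) (simp add: algebra_simps)
        moreover have "x / (s * t) - x / t\<^sup>2 = x * (t - s) / (s * t\<^sup>2)"
          if "s \<noteq> 0" "t \<noteq> 0" for s t x :: complex
          using that by (simp add: field_simps power2_eq_square)
        from this[OF nz(1,2), of "2 * \<zeta>"] have "2 * \<zeta> / ((\<zeta> - w) * (\<zeta> - z)) - ?b \<zeta> = ?e \<zeta>"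
          by simp
        ultimately have "((\<zeta> + w) / (\<zeta> - w) - (\<zeta> + z) / (\<zeta> - z)) / (w - z) - ?b \<zeta> = ?e \<zeta>" by simp
        then show ?case
          by (simp only: left_diff_distrib[symmetric] times_divide_eq_left[symmetric])
      qed
    qed (use borel_measurable_integrable[OF a] in \<open>simp_all, measurable\<close>)
    also have "norm \<dots> \<le> (2 * norm (w - z) / d ^ 3) * M"
      unfolding M_def
    proof (rule integrable_arc_bounded_mult(2)[OF a])
      fix \<zeta> :: complex assume \<zeta>: "norm \<zeta> = 1"
      have "d * d\<^sup>2 \<le> norm (\<zeta> - w) * (norm (\<zeta> - z))\<^sup>2"
        using wd[OF \<zeta>] zd[OF \<zeta>] d by (intro mult_mono power_mono) auto
      then show "norm (?e \<zeta>) \<le> 2 * norm (w - z) / d ^ 3"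
        unfolding norm_divide norm_mult norm_power using \<zeta> d
        by (intro frac_le) (auto simp: power3_eq_cube power2_eq_square mult.assoc)
    qed auto
    finally show ?thesis by (simp add: mult_ac)
  qed
  have "((\<lambda>w. (schwarz_integral a w - schwarz_integral a z) / (w - z) - D) \<longlongrightarrow> 0) (at z)"
  proof (rule Lim_null_comparison)
    show "eventually (\<lambda>w. norm ((schwarz_integral a w - schwarz_integral a z) / (w - z) - D)
        \<le> norm (w - z) * (2 / d ^ 3 * M)) (at z)"
      unfolding eventually_at using est d by (intro exI[of _ d]) (auto simp: dist_norm)
    show "((\<lambda>w. norm (w - z) * (2 / d ^ 3 * M)) \<longlongrightarrow> 0) (at z)"
      by (rule tendsto_eq_intros tendsto_norm refl | simp)+
  qed
  then have "(schwarz_integral a has_field_derivative D) (at z)"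
    by (simp add: has_field_derivative_iff LIM_zero_iff)
  then show "schwarz_integral a field_differentiable at z within unit_disc"
    using field_differentiable_at_within field_differentiable_def by blast
qed

lemma poisson_kernel_nonneg:
  fixes \<zeta> z :: complex
  assumes "norm \<zeta> = 1" "norm z < 1"
  shows "Re ((\<zeta> + z) / (\<zeta> - z)) \<ge> 0"
proof -
  have "Re ((\<zeta> + z) * cnj (\<zeta> - z)) = (norm \<zeta>)\<^sup>2 - (norm z)\<^sup>2"
    unfolding cmod_power2 by (simp add: algebra_simps power2_eq_square)
  also have "\<dots> \<ge> 0" using assms by (simp add: power_le_one)
  finally show ?thesis by (simp add: Re_complex_div_ge_0)
qed

text \<open>On the circle the Schwarz kernel is the conjugate of \<open>W\<close>, which is
  holomorphic in \<open>\<zeta>\<close> across the circle with \<open>W 0 = 1\<close>.\<close>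

lemma poisson_kernel_mean:
  assumes z: "norm z < 1"
  shows "has_bochner_integral arc_measure (\<lambda>\<zeta>. Re ((\<zeta> + z) / (\<zeta> - z))) 1"
proof -
  define W where "W \<zeta> = (1 + cnj z * \<zeta>) / (1 - cnj z * \<zeta>)" for \<zeta>
  \<comment> \<open>A radius above 1 with \<open>norm z * ?\<rho> < 1\<close>, finite also for
    \<open>z = 0\<close>.\<close>
  let ?\<rho> = "2 / (1 + norm z)"
  have \<rho>: "1 < ?\<rho>" using z by (subst less_divide_eq_1) (auto simp: add_pos_nonneg)
  have "cnj z * \<zeta> \<noteq> 1" if "norm \<zeta> < ?\<rho>" for \<zeta>
  proof -
    have pos: "1 + norm z > 0" by (simp add: add_pos_nonneg)
    have "norm z * norm \<zeta> \<le> norm z * ?\<rho>" using that by (intro mult_left_mono) auto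
    also have "\<dots> < 1" using pos z by (simp add: divide_simps)
    finally show ?thesis by (metis complex_mod_cnj norm_mult norm_one less_irrefl)
  qed
  then have "W holomorphic_on ball 0 ?\<rho>"
    unfolding W_def by (intro holomorphic_intros) (auto simp: eq_commute[of 1])
  from holomorphic_mean_value_Re[OF this _ \<rho>]
  have mv: "has_bochner_integral arc_measure (\<lambda>\<zeta>. indicator (sphere 0 1) \<zeta> * Re (W \<zeta>)) 1"
    by (simp add: W_def)
  show ?thesis
  proof (rule has_bochner_integral_cong_AE[THEN iffD1, OF _ _ _ mv])
    show "AE \<zeta> in arc_measure. indicator (sphere 0 1) \<zeta> * Re (W \<zeta>) = Re ((\<zeta> + z) / (\<zeta> - z))"
      using AE_arc_norm
    proof eventually_elim
      case (elim \<zeta>)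
      then have 1: "cnj \<zeta> * \<zeta> = 1" by (simp add: complex_norm_square[symmetric] mult.commute)
      have nz: "\<zeta> \<noteq> 0" using elim by auto
      have "cnj (W \<zeta>) = ((1 + z * cnj \<zeta>) * \<zeta>) / ((1 - z * cnj \<zeta>) * \<zeta>)"
        using nz by (simp add: W_def)
      also have "\<dots> = (\<zeta> + z) / (\<zeta> - z)"
        by (simp add: distrib_right left_diff_distrib mult.assoc 1)
      finally have "Re (W \<zeta>) = Re ((\<zeta> + z) / (\<zeta> - z))" by (metis complex_cnj(1) cnj.simps(1))
      then show ?case using elim by simp
    qed
    show "(\<lambda>\<zeta>. indicator (sphere 0 1) \<zeta> * Re (W \<zeta>)) \<in> borel_measurable arc_measure"
      using mv by (auto simp: has_bochner_integral_iff dest: borel_measurable_integrable)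
  qed simp
qed

text \<open>The real part is the mean of \<open>a\<close> weighted by the Poisson kernel, which is
  nonnegative with mean 1.\<close>

lemma Re_schwarz_integral_ge:
  assumes a: "integrable arc_measure a" "\<And>\<zeta>. c \<le> a \<zeta>" and z: "norm z < 1"
  shows "c \<le> Re (schwarz_integral a z)"
proof -
  let ?k = "\<lambda>\<zeta>. (\<zeta> + z) / (\<zeta> - z)"
  note k = poisson_kernel_mean[OF z]
  have ki: "integrable arc_measure (\<lambda>\<zeta>. Re (?k \<zeta> * of_real (a \<zeta>)))"
    using schwarz_integrable[OF a(1) z] by (rule integrable_Re)
  have "c = (LINT \<zeta>|arc_measure. c * Re (?k \<zeta>))"
    using k by (simp add: has_bochner_integral_iff)
  also have "\<dots> \<le> (LINT \<zeta>|arc_measure. Re (?k \<zeta> * of_real (a \<zeta>)))"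
  proof (rule integral_mono_AE[OF _ ki])
    show "AE \<zeta> in arc_measure. c * Re (?k \<zeta>) \<le> Re (?k \<zeta> * of_real (a \<zeta>))"
      using AE_arc_norm
    proof eventually_elim
      case (elim \<zeta>)
      have "c * Re (?k \<zeta>) \<le> a \<zeta> * Re (?k \<zeta>)"
        using a(2) poisson_kernel_nonneg[OF elim z] by (rule mult_right_mono)
      moreover have "Re (x * of_real t) = t * Re x" for x t by simp
      ultimately show ?case by (simp only:)
    qed
  qed (use k in \<open>auto simp: has_bochner_integral_iff\<close>)
  also have "\<dots> = Re (schwarz_integral a z)"
    unfolding schwarz_integral_def by (rule integral_Re[OF schwarz_integrable[OF a(1) z]])
  finally show ?thesis .
qed

lemma schwarz_integral_diff:
  assumes "integrable arc_measure a" "integrable arc_measure b" "norm z < 1"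
  shows "schwarz_integral (\<lambda>\<zeta>. a \<zeta> - b \<zeta>) z = schwarz_integral a z - schwarz_integral b z"
  unfolding schwarz_integral_def of_real_diff right_diff_distrib
  by (rule Bochner_Integration.integral_diff) (use assms schwarz_integrable in auto)

lemma schwarz_integral_0:
  assumes "integrable arc_measure a"
  shows "schwarz_integral a 0 = of_real (LINT \<zeta>|arc_measure. a \<zeta>)"
proof -
  have "schwarz_integral a 0 = (LINT \<zeta>|arc_measure. of_real (a \<zeta>))"
    unfolding schwarz_integral_def
  proof (rule integral_cong_AE)
    show "AE \<zeta> in arc_measure. (\<zeta> + 0) / (\<zeta> - 0) * of_real (a \<zeta>) = complex_of_real (a \<zeta>)"
      using AE_arc_norm by eventually_elim auto
  qed (use borel_measurable_integrable[OF assms] in \<open>simp_all, measurable\<close>)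
  then show ?thesis by simp
qed

section \<open>Rescaling of liftings and truncated outer functions\<close>

lemma cproj_of_smult:
  assumes "c \<noteq> 0" "v \<noteq> 0" shows "cproj_of (c *s v) = cproj_of v"
proof -
  have "c *s v \<noteq> 0" using assms by (simp add: vec_eq_iff)
  then have "same_line v (c *s v)" using assms unfolding same_line_def by blast
  then show ?thesis using Quotient3_rel_abs[OF Quotient3_cproj] by metis
qed

lemma bounded_lifting_smult:
  assumes F: "bounded_lifting f F" and \<phi>: "\<phi> holomorphic_on unit_disc"
    "\<And>z. z \<in> unit_disc \<Longrightarrow> \<phi> z \<noteq> 0" "\<And>z. z \<in> unit_disc \<Longrightarrow> norm (\<phi> z) \<le> B"
  shows "bounded_lifting f (\<lambda>z. \<phi> z *s F z)"
  unfolding bounded_lifting_def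
proof (intro conjI allI ballI)
  fix k
  show "(\<lambda>z. (\<phi> z *s F z) $ k) holomorphic_on unit_disc"
    using F \<phi>(1) by (auto simp: bounded_lifting_def intro!: holomorphic_intros)
  have "\<exists>b. \<forall>z\<in>unit_disc. norm (F z $ k) \<le> b"
    using F unfolding bounded_lifting_def bounded_iff by simp
  then obtain b where b: "\<And>z. z \<in> unit_disc \<Longrightarrow> norm (F z $ k) \<le> b" by blast
  have "norm ((\<phi> z *s F z) $ k) \<le> B * b" if "z \<in> unit_disc" for z
    using \<phi>(3)[OF that] b[OF that] by (simp add: norm_mult) (meson mult_mono norm_ge_zero order_trans)
  then show "bounded ((\<lambda>z. (\<phi> z *s F z) $ k) ` unit_disc)" unfolding bounded_iff by blast
next
  fix z assume z: "z \<in> unit_disc"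
  then have "F z \<noteq> 0" "cproj_of (F z) = f z" using F by (auto simp: bounded_lifting_def)
  with \<phi>(2)[OF z] show "\<phi> z *s F z \<noteq> 0" "cproj_of (\<phi> z *s F z) = f z"
    by (auto simp: cproj_of_smult vec_eq_iff)
qed

text \<open>Dividing the lifting by the outer function itself would in general destroy boundedness, so
  we divide by the outer function with boundary values \<open>max k (exp (- N))\<close> and let
  \<open>N\<close> tend to infinity.\<close>

lemma lelong_class_le_inner_factor:
  fixes X :: "(complex ^ ('n::finite)) set"
  assumes X: "open X" and f: "f \<in> disc_class X" "f 0 = affine_emb z"
    and F: "bounded_lifting f F" and g: "inner_factor g (\<lambda>w. F w $ None)"
    and u: "u \<in> lelong_class" "\<And>x. x \<in> X \<Longrightarrow> u x \<le> 0"
  shows "u z \<le> ereal (- ln (norm (g 0)))"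
proof -
  obtain h where h: "outer_function h" "\<And>w. w \<in> unit_disc \<Longrightarrow> F w $ None = g w * h w"
    and g1: "\<And>w. w \<in> unit_disc \<Longrightarrow> norm (g w) \<le> 1"
    using g unfolding inner_factor_def inner_function_def by blast
  obtain c k where c: "norm c = 1" and k: "integrable arc_measure (\<lambda>\<zeta>. ln (k \<zeta>))"
    and hk: "\<And>w. w \<in> unit_disc \<Longrightarrow> h w = c * exp (schwarz_integral (\<lambda>\<zeta>. ln (k \<zeta>)) w)"
    using h(1) unfolding outer_function_def schwarz_integral_def by blast
  have "F 0 \<noteq> 0" "cproj_of (F 0) = affine_emb z"
    using F f(2) by (auto simp: bounded_lifting_def)
  from cproj_of_eq_affine_emb(1)[OF this] h(2)[of 0] have g0: "g 0 \<noteq> 0" by auto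
  interpret finite_measure arc_measure by (rule finite_measure_arc)
  \<comment> \<open>The logarithm of the truncated boundary values; its lower bound
    \<open>- real N\<close> bounds the factor \<open>exp (- A w)\<close> below.\<close>
  define a where "a N \<zeta> = max (ln (k \<zeta>)) (- real N)" for N \<zeta>
  define q where "q N \<zeta> = a N \<zeta> - ln (k \<zeta>)" for N \<zeta>
  have ai: "integrable arc_measure (a N)" for N unfolding a_def using k by simp
  have qi: "integrable arc_measure (q N)" for N unfolding q_def using k ai by simp
  have le: "u z \<le> ereal (- ln (norm (g 0)) + (LINT \<zeta>|arc_measure. q N \<zeta>))" for N
  proof -
    define A where "A = schwarz_integral (a N)"
    define G where "G w = exp (- A w) *s F w" for w
    have G: "bounded_lifting f G"
      unfolding G_def
    proof (rule bounded_lifting_smult[OF F])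
      show "(\<lambda>w. exp (- A w)) holomorphic_on unit_disc"
        unfolding A_def by (intro holomorphic_intros schwarz_integral_holomorphic ai)
      show "norm (exp (- A w)) \<le> exp (real N)" if "w \<in> unit_disc" for w
        using Re_schwarz_integral_ge[OF ai, of "- real N" N w] that by (simp add: a_def A_def)
    qed auto
    \<comment> \<open>What remains beside \<open>g\<close> is the outer function with exponent
      \<open>- q N\<close>, of modulus at most 1 because \<open>q N\<close> is nonnegative.\<close>
    have GN: "norm (G w $ None) = norm (g w) * exp (- Re (schwarz_integral (q N) w))"
      if w: "w \<in> unit_disc" for w
    proof -
      have "schwarz_integral (q N) w = A w - schwarz_integral (\<lambda>\<zeta>. ln (k \<zeta>)) w"
        unfolding q_def A_def using w by (intro schwarz_integral_diff ai k) auto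
      moreover have "norm (G w $ None) =
          exp (- Re (A w)) * (norm (g w) * exp (Re (schwarz_integral (\<lambda>\<zeta>. ln (k \<zeta>)) w)))"
        by (simp add: G_def h(2)[OF w] hk[OF w] norm_mult c)
      moreover have "exp (- (x - y)) = exp (- x) * exp y" for x y :: real
        by (simp flip: exp_add)
      ultimately show ?thesis by simp
    qed
    have "norm (G w $ None) \<le> 1" if w: "w \<in> unit_disc" for w
    proof -
      have "0 \<le> Re (schwarz_integral (q N) w)"
        using w by (intro Re_schwarz_integral_ge qi) (auto simp: q_def a_def)
      then have "norm (g w) * exp (- Re (schwarz_integral (q N) w)) \<le> 1 * 1"
        using g1[OF w] by (intro mult_mono) auto
      then show ?thesis by (simp add: GN[OF w])
    qed
    from lelong_class_le_bounded_lifting[OF X f G this u]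
    have "u z \<le> ereal (- ln (norm (G 0 $ None)))" by simp
    \<comment> \<open>At 0 the Schwarz integral is the plain mean, so the loss against
      \<open>g 0\<close> is the integral of \<open>q N\<close>.\<close>
    also have "- ln (norm (G 0 $ None)) = - ln (norm (g 0)) + (LINT \<zeta>|arc_measure. q N \<zeta>)"
      using g0 by (simp add: GN schwarz_integral_0[OF qi] ln_mult)
    finally show ?thesis .
  qed
  have "(\<lambda>N. LINT \<zeta>|arc_measure. q N \<zeta>) \<longlonglongrightarrow> (LINT \<zeta>|arc_measure. 0)"
  proof (rule integral_dominated_convergence[where w = "\<lambda>\<zeta>. \<bar>ln (k \<zeta>)\<bar>"])
    show "AE \<zeta> in arc_measure. (\<lambda>N. q N \<zeta>) \<longlonglongrightarrow> 0"
    proof (rule AE_I2)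
      fix \<zeta>
      obtain n where "- ln (k \<zeta>) \<le> real n" using real_arch_simple by blast
      then have "q N \<zeta> = 0" if "N \<ge> n" for N
        using that of_nat_mono[OF that, where 'a = real] unfolding q_def a_def by linarith
      then show "(\<lambda>N. q N \<zeta>) \<longlonglongrightarrow> 0"
        by (intro tendsto_eventually) (auto simp: eventually_sequentially)
    qed
    show "AE \<zeta> in arc_measure. norm (q N \<zeta>) \<le> \<bar>ln (k \<zeta>)\<bar>" for N
      by (rule AE_I2) (auto simp: q_def a_def)
  qed (use k qi in \<open>auto dest: borel_measurable_integrable\<close>)
  then have "(\<lambda>N. ereal (- ln (norm (g 0)) + (LINT \<zeta>|arc_measure. q N \<zeta>)))
      \<longlonglongrightarrow> ereal (- ln (norm (g 0)) + 0)"
    by (intro tendsto_intros) simp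
  from LIMSEQ_le_const[OF this, of "u z"] le show ?thesis unfolding add_0_right by blast
qed

section \<open>Comparison of the extremal function with the envelope\<close>

theorem proposition2:
  fixes X :: "(complex ^ ('n::finite)) set"
  assumes "open X"
  shows "\<forall>z. siciak X z \<le> envelope (disc_class X) disc_functional (affine_emb z)"
proof
  fix z
  show "siciak X z \<le> envelope (disc_class X) disc_functional (affine_emb z)"
    unfolding siciak_def envelope_def
  proof (intro Sup_least Inf_greatest, clarify)
    fix u f
    assume u: "u \<in> lelong_class" "\<forall>x\<in>X. u x \<le> 0" and f: "f \<in> disc_class X" "f 0 = affine_emb z"
    \<comment> \<open>\<open>disc_functional\<close> is minus this supremum, so it suffices to bound
      each lifting and each of its inner factors.\<close>
    have "Sup {ereal (ln (norm (g 0))) | F g.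
        bounded_lifting f F \<and> inner_factor g (\<lambda>z. F z $ None)} \<le> - u z"
    proof (rule Sup_least, clarify)
      fix F g assume "bounded_lifting f F" "inner_factor g (\<lambda>z. F z $ None)"
      from lelong_class_le_inner_factor[OF assms f this u(1)] u(2)
      have "u z \<le> - ereal (ln (norm (g 0)))" by simp
      then show "ereal (ln (norm (g 0))) \<le> - u z" by (cases "u z") auto
    qed
    then show "u z \<le> disc_functional f"
      unfolding disc_functional_def by (subst ereal_minus_le_minus[symmetric]) simp
  qed
qed


end
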